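(* Consider $SO_0(1,7)/G_2$, and let $T$ be a $G$-invariant symmetric $(0,2)$-tensor, determined by $(t_1,t_2,t_3)\in\mathbb{R}^3$ with $t_1=T(x_1,x_1)$, $t_2=T(x_8,x_8)$, $t_3=T(x_1,x_8)$. Then there is a $G$-invariant metric on $SO_0(1,7)/G_2$ with $\mathrm{ric}=T$ if and only if $(t_1,t_2,t_3)$ is such that: Case 1: if $t_3=0$, then $t_1=6t_2^2+6t_2+\frac{15}{8}$ with $t_2<-\frac12$. Case 2: if $t_3\neq0$, then $$t_1=\begin{cases} f_1(t_2,t_3), & t_2\le-\frac34 \text{ and } |t_3|>0,\\ f_1(t_2,t_3), & -\frac34<t_2\le-\frac12,\ |t_3|>0 \text{ and } |t_3|\neq\frac12\sqrt{\frac32}\sqrt{4t_2+3},\\ f_1(t_2,t_3), & t_2>-\frac12,\ |t_3|>\frac{\sqrt3}{4}\sqrt{2t_2+1} \text{ and } |t_3|\neq\frac12\sqrt{\frac32}\sqrt{4t_2+3},\\ \frac34, & t_2>-\frac34 \text{ and } |t_3|=\frac12\sqrt{\frac32}\sqrt{4t_2+3},\end{cases}$$ where $f_1(t_2,t_3)$ is the first (smallest) real root, in increasing order, of the following polynomial in $t_1$: $$128t_1^3+t_1^2\left(-768t_2^2-768t_2-432\right)+t_1\left(1152t_2^2+1536t_2t_3^2+1152t_2+1536t_3^2+432\right)-432t_2^2-432t_2-768t_3^4-288t_3^2-135.$$ (In Case 2, $T$ is required to satisfy the condition of one of the four lines, with the corresponding value of $t_1$.)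
   Context: Here $G=SO_0(1,7)$, $\mathfrak{g}=\mathfrak{so}(1,7)$, $\mathfrak{k}=\mathfrak{so}(7)$ is the maximal compact subalgebra, and $\mathfrak{h}=\mathfrak{g}_2\subset\mathfrak{so}(7)$ is embedded by the irreducible $7$-dimensional representation. Write $\mathfrak{so}(7)=\mathfrak{g}_2\oplus\mathfrak{p}_1$ ($\mathfrak{p}_1$ the Killing-orthogonal complement) and $\mathfrak{g}=\mathfrak{k}\oplus\mathfrak{p}_2$ (Cartan decomposition). Then $\mathfrak{p}_1\simeq\mathfrak{p}_2$ are equivalent irreducible $7$-dimensional $\mathrm{ad}_{\mathfrak{g}_2}$-representations, and $\mathfrak{p}=\mathfrak{p}_1\oplus\mathfrak{p}_2\cong T_{eH}(G/H)$. $G$-invariant metrics and symmetric $(0,2)$-tensors are identified with $\mathrm{ad}_{\mathfrak{g}_2}$-invariant inner products and symmetric bilinear forms on $\mathfrak{p}$. With $B$ the Killing form of $\mathfrak{so}(1,7)$, the fixed inner product is $\langle\cdot,\cdot\rangle=B|_{\mathfrak{p}_2}-B|_{\mathfrak{p}_1}$ (with $\mathfrak{p}_1\perp\mathfrak{p}_2$). Fix a $\langle\cdot,\cdot\rangle$-orthonormal basis $\{x_1,\dots,x_{14}\}$ of $\mathfrak{p}$, with $x_1,\dots,x_7\in\mathfrak{p}_1$ and $x_{7+i}=Lx_i\in\mathfrak{p}_2$, where $L:\mathfrak{p}_1\to\mathfrak{p}_2$ is an $\mathrm{ad}_{\mathfrak{g}_2}$-equivariant linear isometry (unique up to sign). In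 this basis each $\mathrm{ad}_{\mathfrak{g}_2}$-invariant symmetric bilinear form $T$ has matrix $\begin{pmatrix}t_1 I_7&t_3I_7\\t_3I_7&t_2I_7\end{pmatrix}$. $\mathrm{ric}$ is the $(0,2)$ Ricci tensor. *)

theory Defs
  imports "HOL-Analysis.Analysis" "HOL-Library.Numeral_Type"
begin

section \<open>Invariant metrics on reductive homogeneous spaces of matrix groups\<close>

text \<open>
  Throughout, a homogeneous space \<open>G/H\<close> of a matrix group enters through the Lie algebra \<open>h\<close>
  of the (connected) isotropy group \<open>H\<close> and a reductive complement \<open>m\<close> of \<open>h\<close> in the Lie algebra
  of \<open>G\<close>; \<open>m\<close> is identified with the tangent space at \<open>eH\<close>, and \<open>G\<close>-invariant symmetric
  \<open>(0,2)\<close>-tensors with \<open>ad h\<close>-invariant symmetric bilinear forms on \<open>m\<close>.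
  Forms and operators on \<open>m\<close> are total functions whose values outside \<open>m\<close> are irrelevant.
\<close>

definition lie :: "real^'n^'n \<Rightarrow> real^'n^'n \<Rightarrow> real^'n^'n" where
  "lie A B = A ** B - B ** A"

definition trace_on :: "'a::real_vector set \<Rightarrow> ('a \<Rightarrow> 'a) \<Rightarrow> real" where
  "trace_on V f =
     (let B = (SOME B. independent B \<and> span B = V) in \<Sum>b\<in>B. representation B (f b) b)"

definition killing :: "(real^'n^'n) set \<Rightarrow> real^'n^'n \<Rightarrow> real^'n^'n \<Rightarrow> real" where
  "killing \<gg> X Y = trace_on \<gg> (\<lambda>Z. lie X (lie Y Z))"

text \<open>The \<open>V\<close>-component of \<open>X\<close> with respect to a direct sum decomposition \<open>V \<oplus> W\<close>.\<close>

definition component :: "'a::real_vector set \<Rightarrow> 'a set \<Rightarrow> 'a \<Rightarrow> 'a" where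
  "component V W X = (THE Y. Y \<in> V \<and> X - Y \<in> W)"

definition linear_map_on :: "'a::real_vector set \<Rightarrow> ('a \<Rightarrow> 'b::real_vector) \<Rightarrow> bool" where
  "linear_map_on V f \<longleftrightarrow>
     (\<forall>X\<in>V. \<forall>Y\<in>V. f (X + Y) = f X + f Y) \<and> (\<forall>c. \<forall>X\<in>V. f (c *\<^sub>R X) = c *\<^sub>R f X)"

definition invariant_sym_form ::
    "(real^'n^'n) set \<Rightarrow> (real^'n^'n) set \<Rightarrow> (real^'n^'n \<Rightarrow> real^'n^'n \<Rightarrow> real) \<Rightarrow> bool" where
  "invariant_sym_form h m T \<longleftrightarrow>
     (\<forall>Y\<in>m. linear_map_on m (\<lambda>X. T X Y)) \<and>
     (\<forall>X\<in>m. \<forall>Y\<in>m. T X Y = T Y X) \<and>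
     (\<forall>Z\<in>h. \<forall>X\<in>m. \<forall>Y\<in>m. T (lie Z X) Y + T X (lie Z Y) = 0)"

definition invariant_metric ::
    "(real^'n^'n) set \<Rightarrow> (real^'n^'n) set \<Rightarrow> (real^'n^'n \<Rightarrow> real^'n^'n \<Rightarrow> real) \<Rightarrow> bool" where
  "invariant_metric h m g \<longleftrightarrow>
     invariant_sym_form h m g \<and> (\<forall>X\<in>m. X \<noteq> 0 \<longrightarrow> g X X > 0)"

text \<open>
  In Nomizu's description of invariant affine connections on a reductive space by bilinear maps
  \<open>\<Lambda> : m \<times> m \<rightarrow> m\<close>, the torsion is \<open>\<Lambda> X Y - \<Lambda> Y X - [X,Y]\<^sub>m\<close>, and the connection preserves \<open>g\<close>
  iff every \<open>\<Lambda> X\<close> is \<open>g\<close>-skew. On \<open>m\<close> the torsion-free metric \<open>\<Lambda>\<close> is unique, hence automatically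
  \<open>ad h\<close>-equivariant.
\<close>

definition levi_civita ::
    "(real^'n^'n) set \<Rightarrow> (real^'n^'n) set \<Rightarrow> (real^'n^'n \<Rightarrow> real^'n^'n \<Rightarrow> real) \<Rightarrow>
     (real^'n^'n \<Rightarrow> real^'n^'n \<Rightarrow> real^'n^'n) \<Rightarrow> bool" where
  "levi_civita h m g \<Lambda> \<longleftrightarrow>
     (\<forall>X\<in>m. \<forall>Y\<in>m. \<Lambda> X Y \<in> m) \<and>
     (\<forall>X\<in>m. linear_map_on m (\<Lambda> X)) \<and>
     (\<forall>Y\<in>m. linear_map_on m (\<lambda>X. \<Lambda> X Y)) \<and>
     (\<forall>X\<in>m. \<forall>Y\<in>m. \<Lambda> X Y - \<Lambda> Y X = component m h (lie X Y)) \<and>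
     (\<forall>X\<in>m. \<forall>Y\<in>m. \<forall>Z\<in>m. g (\<Lambda> X Y) Z + g Y (\<Lambda> X Z) = 0)"

definition curvature ::
    "(real^'n^'n) set \<Rightarrow> (real^'n^'n) set \<Rightarrow> (real^'n^'n \<Rightarrow> real^'n^'n \<Rightarrow> real^'n^'n) \<Rightarrow>
     real^'n^'n \<Rightarrow> real^'n^'n \<Rightarrow> real^'n^'n \<Rightarrow> real^'n^'n" where
  "curvature h m \<Lambda> X Y Z =
     \<Lambda> X (\<Lambda> Y Z) - \<Lambda> Y (\<Lambda> X Z)
       - \<Lambda> (component m h (lie X Y)) Z - lie (component h m (lie X Y)) Z"

text \<open>With this sign of the curvature, round spheres have positive Ricci curvature.\<close>

definition ricci ::
    "(real^'n^'n) set \<Rightarrow> (real^'n^'n) set \<Rightarrow> (real^'n^'n \<Rightarrow> real^'n^'n \<Rightarrow> real) \<Rightarrow>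
     real^'n^'n \<Rightarrow> real^'n^'n \<Rightarrow> real" where
  "ricci h m g Y Z =
     trace_on m (\<lambda>X. curvature h m (SOME \<Lambda>. levi_civita h m g \<Lambda>) X Y Z)"

section \<open>The homogeneous space \<open>SO\<^sub>0(1,7)/G\<^sub>2\<close>\<close>

text \<open>
  Coordinates of \<open>\<real>\<^sup>1\<^sup>,\<^sup>7\<close> are indexed by \<open>7 option\<close>: \<open>None\<close> is the coordinate with negative square,
  \<open>Some i\<close> (\<open>i\<close> modulo 7) are the others. The same index set is used for the octonions, \<open>None\<close>
  belonging to the unit and \<open>Some i\<close> to the imaginary unit \<open>e\<^sub>i\<close>.
\<close>

type_synonym mat8 = "real^(7 option)^(7 option)"

definition eta :: mat8 where
  "eta = (\<chi> i j. if i = j then (if i = None then -1 else 1) else 0)"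

definition so17 :: "mat8 set" where
  "so17 = {A. transpose A ** eta + eta ** A = 0}"

text \<open>
  \<open>so7\<close> and \<open>p2\<close> are the eigenspaces of the Cartan involution \<open>A \<mapsto> - transpose A\<close> of \<open>so17\<close>;
  the elements of \<open>so7\<close> are the skew matrices with vanishing \<open>None\<close> row and column.
\<close>

definition so7 :: "mat8 set" where
  "so7 = {A \<in> so17. transpose A = - A}"

definition p2 :: "mat8 set" where
  "p2 = {A \<in> so17. transpose A = A}"

text \<open>
  Octonion multiplication with \<open>e\<^sub>i e\<^sub>i\<^sub>+\<^sub>1 = e\<^sub>i\<^sub>+\<^sub>3\<close> (indices modulo 7, and cyclic permutations of
  each such triple); \<open>e\<^sub>k\<close> is thus \<open>e\<^sub>k\<^sub>+\<^sub>1 e\<^sub>k\<^sub>+\<^sub>3 = e\<^sub>k\<^sub>+\<^sub>2 e\<^sub>k\<^sub>+\<^sub>6 = e\<^sub>k\<^sub>+\<^sub>4 e\<^sub>k\<^sub>+\<^sub>5\<close>.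
\<close>

definition oct_mult :: "real^(7 option) \<Rightarrow> real^(7 option) \<Rightarrow> real^(7 option)" where
  "oct_mult x y = (\<chi> j. case j of
       None \<Rightarrow> x $ None * y $ None - (\<Sum>i\<in>UNIV. x $ Some i * y $ Some i)
     | Some k \<Rightarrow> x $ None * y $ Some k + x $ Some k * y $ None
         + (x $ Some (k+1) * y $ Some (k+3) - x $ Some (k+3) * y $ Some (k+1))
         + (x $ Some (k+2) * y $ Some (k+6) - x $ Some (k+6) * y $ Some (k+2))
         + (x $ Some (k+4) * y $ Some (k+5) - x $ Some (k+5) * y $ Some (k+4)))"

text \<open>
  \<open>\<gg>\<^sub>2\<close> is the derivation algebra of the octonions; its action on the imaginary octonions is the
  irreducible 7-dimensional representation.
\<close>

definition g2 :: "mat8 set" where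
  "g2 = {D \<in> so7. \<forall>x y. D *v oct_mult x y = oct_mult (D *v x) y + oct_mult x (D *v y)}"

definition p1 :: "mat8 set" where
  "p1 = {X \<in> so7. \<forall>Y\<in>g2. killing so7 X Y = 0}"

definition pp :: "mat8 set" where
  "pp = {X + Y | X Y. X \<in> p1 \<and> Y \<in> p2}"

definition ip :: "mat8 \<Rightarrow> mat8 \<Rightarrow> real" where
  "ip X Y = killing so17 (component p2 p1 X) (component p2 p1 Y)
          - killing so17 (component p1 p2 X) (component p1 p2 Y)"

definition equivariant_isometry :: "(mat8 \<Rightarrow> mat8) \<Rightarrow> bool" where
  "equivariant_isometry L \<longleftrightarrow>
     linear_map_on p1 L \<and> L ` p1 = p2 \<and>
     (\<forall>Z\<in>g2. \<forall>X\<in>p1. L (lie Z X) = lie Z (L X)) \<and>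
     (\<forall>X\<in>p1. \<forall>Y\<in>p1. ip (L X) (L Y) = ip X Y)"

definition adapted_basis :: "(mat8 \<Rightarrow> mat8) \<Rightarrow> (nat \<Rightarrow> mat8) \<Rightarrow> bool" where
  "adapted_basis L x \<longleftrightarrow>
     span (x ` {1..14}) = pp \<and>
     (\<forall>i\<in>{1..14}. \<forall>j\<in>{1..14}. ip (x i) (x j) = (if i = j then 1 else 0)) \<and>
     (\<forall>i\<in>{1..7}. x i \<in> p1 \<and> x (7 + i) = L (x i))"

definition cubic :: "real \<Rightarrow> real \<Rightarrow> real \<Rightarrow> real" where
  "cubic t2 t3 t1 =
     128 * t1^3
     + t1^2 * (- 768 * t2^2 - 768 * t2 - 432)
     + t1 * (1152 * t2^2 + 1536 * t2 * t3^2 + 1152 * t2 + 1536 * t3^2 + 432)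
     - 432 * t2^2 - 432 * t2 - 768 * t3^4 - 288 * t3^2 - 135"

definition f1 :: "real \<Rightarrow> real \<Rightarrow> real" where
  "f1 t2 t3 = Min {t1. cubic t2 t3 t1 = 0}"

end

theory Submission
  imports Defs
begin

text \<open>
  By Schur's lemma an invariant symmetric form on \<open>\<pp> = \<pp>\<^sub>1 \<oplus> \<pp>\<^sub>2\<close>, identified with \<open>\<real>\<^sup>7 \<oplus> \<real>\<^sup>7\<close>, is
  given by three numbers, and an equivariant bilinear map \<open>\<pp> \<times> \<pp> \<rightarrow> \<pp>\<close> is assembled from cross
  products. The Levi-Civita connection of an invariant metric depends on two numbers \<open>U > 0\<close> and \<open>V\<close>
  only, all such pairs occur, and the Ricci tensor has the coefficients \<open>27/2 + 6 U\<^sup>2\<close>,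
  \<open>- 6 - 2 U + 6 V\<^sup>2\<close> and \<open>V (6 U + 9)\<close>.

  For \<open>t3 \<noteq> 0\<close> eliminate \<open>V\<close> and put \<open>y = 2 U + 3\<close>: then \<open>T\<close> is a Ricci tensor iff
  \<open>y\<^sup>3/12 + (t2 + 1/4) y\<^sup>2 - 24 t3\<^sup>2\<close> has a root \<open>y > 3\<close> with \<open>t1 = 3/8 + (y - 3)\<^sup>2/24\<close>. This polynomial has exactly one
  positive root; its sign at \<open>3\<close> gives the lower bound on \<open>\<bar>t3\<bar>\<close>. The roots of \<open>cubic\<close> are the values
  \<open>3/8 + (y - 3)\<^sup>2/24\<close> at all three complex roots \<open>y\<close>. The other two are negative and larger in
  absolute value, or non-real with real part different from \<open>3\<close> (so that their values are not real);
  hence the positive root gives the smallest real root of \<open>cubic\<close>.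
  The line \<open>t1 = 3/4\<close> is the case \<open>y = 6\<close>.
\<close>

section \<open>The cross product on \<open>\<real>\<^sup>7\<close>\<close>

lemma UNIV_shift_7: "(UNIV :: 7 set) = {k, k+1, k+2, k+3, k+4, k+5, k+6}"
proof -
  have "(UNIV :: 7 set) = {0,1,2,3,4,5,6}"
    by (rule sym, rule card_subset_eq) simp_all
  then have "range (\<lambda>i::7. k + i) = (\<lambda>i. k + i) ` {0,1,2,3,4,5,6}"
    by simp
  moreover have "range (\<lambda>i::7. k + i) = UNIV"
    by (metis surj_def add.commute diff_add_cancel)
  ultimately show ?thesis by simp
qed

text \<open>Starting the sum at an arbitrary \<open>k\<close> keeps all indices in the form
  \<open>k + c\<close>. The multiplication table is invariant under cyclic shifts, so one
  computation relative to \<open>k\<close> covers every component.\<close>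

lemma sum_shift_7:
  fixes f :: "7 \<Rightarrow> 'a::comm_monoid_add"
  shows "(\<Sum>i\<in>UNIV. f i) = f k + f (k+1) + f (k+2) + f (k+3) + f (k+4) + f (k+5) + f (k+6)"
  by (subst UNIV_shift_7[of k]) (simp add: add.assoc)

lemma shift_7_cases:
  fixes i k :: 7
  obtains "i = k" | "i = k+1" | "i = k+2" | "i = k+3" | "i = k+4" | "i = k+5" | "i = k+6"
  using UNIV_shift_7[of k] by blast

lemma all_shift_7:
  "(\<forall>i::7. P i) \<longleftrightarrow> P k \<and> P (k+1) \<and> P (k+2) \<and> P (k+3) \<and> P (k+4) \<and> P (k+5) \<and> P (k+6)"
  by (metis shift_7_cases)

text \<open>Two offsets of at most 6 add up to at most 12, so these rules bring
  \<open>k + (a + b)\<close> to a canonical offset.\<close>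

lemma numeral_7_reduce [simp]:
  "(7::7) = 0" "(8::7) = 1" "(9::7) = 2" "(10::7) = 3" "(11::7) = 4" "(12::7) = 5"
  by simp_all

text \<open>The imaginary part of the product of two imaginary octonions; the three brackets are the
  lines of the Fano plane through \<open>k\<close>.\<close>

definition cross :: "real^7 \<Rightarrow> real^7 \<Rightarrow> real^7" where
  "cross v w = (\<chi> k. (v $ (k+1) * w $ (k+3) - v $ (k+3) * w $ (k+1))
      + (v $ (k+2) * w $ (k+6) - v $ (k+6) * w $ (k+2))
      + (v $ (k+4) * w $ (k+5) - v $ (k+5) * w $ (k+4)))"

lemma cross_nth: "cross v w $ k = (v $ (k+1) * w $ (k+3) - v $ (k+3) * w $ (k+1))
      + (v $ (k+2) * w $ (k+6) - v $ (k+6) * w $ (k+2))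
      + (v $ (k+4) * w $ (k+5) - v $ (k+5) * w $ (k+4))"
  by (simp add: cross_def)

lemma cross_add_left: "cross (v + v') w = cross v w + cross v' w"
  and cross_add_right: "cross v (w + w') = cross v w + cross v w'"
  and cross_scaleR_left: "cross (c *\<^sub>R v) w = c *\<^sub>R cross v w"
  and cross_scaleR_right: "cross v (c *\<^sub>R w) = c *\<^sub>R cross v w"
  and cross_minus_left: "cross (- v) w = - cross v w"
  and cross_minus_right: "cross v (- w) = - cross v w"
  and cross_diff_left: "cross (v - v') w = cross v w - cross v' w"
  and cross_diff_right: "cross v (w - w') = cross v w - cross v w'"
  and cross_zero_left [simp]: "cross 0 w = 0"
  and cross_zero_right [simp]: "cross v 0 = 0"
  by (simp_all add: vec_eq_iff cross_nth algebra_simps)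

lemmas cross_linear = cross_add_left cross_add_right cross_scaleR_left cross_scaleR_right
  cross_minus_left cross_minus_right cross_diff_left cross_diff_right

lemma cross_skew: "cross w v = - cross v w"
  by (simp add: vec_eq_iff cross_nth algebra_simps)

lemma inner_shift_7: "(v::real^7) \<bullet> w = v$k * w$k + v$(k+1) * w$(k+1) + v$(k+2) * w$(k+2)
    + v$(k+3) * w$(k+3) + v$(k+4) * w$(k+4) + v$(k+5) * w$(k+5) + v$(k+6) * w$(k+6)"
  by (simp add: inner_vec_def sum_shift_7[of _ k])

lemma inner_cross_skew: "cross v w \<bullet> u = - (w \<bullet> cross v u)"
  by (simp add: inner_shift_7[of _ _ 0] cross_nth algebra_simps)

text \<open>Octonionic analogue of the double cross product formula. Read as a statement about
  matrices, it computes the bracket of \<open>p1\<close> with itself.\<close>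

lemma cross_commutator:
  "cross v (cross w u) - cross w (cross v u) =
     - 2 *\<^sub>R cross (cross v w) u - 3 *\<^sub>R ((w \<bullet> u) *\<^sub>R v - (v \<bullet> u) *\<^sub>R w)"
proof -
  have "(cross v (cross w u) - cross w (cross v u)) $ k =
     (- 2 *\<^sub>R cross (cross v w) u - 3 *\<^sub>R ((w \<bullet> u) *\<^sub>R v - (v \<bullet> u) *\<^sub>R w)) $ k" for k
    by (simp add: inner_shift_7[of _ _ k] cross_nth add.assoc) (simp add: algebra_simps)
  then show ?thesis by (simp only: vec_eq_iff simp_thms)
qed

lemma trace_cross_right: "(\<Sum>i\<in>UNIV. cross (axis i 1) w $ i) = 0"
  by (simp add: sum_shift_7[of _ 0] cross_nth axis_def)

text \<open>Left multiplication by a unit vector is a complex structure on its 6-dimensional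
  orthogonal complement, hence the 6. Traces of this kind are the contractions that occur in the
  Ricci tensor.\<close>

lemma trace_cross_cross: "(\<Sum>i\<in>UNIV. cross w (cross (axis i 1) u) $ i) = 6 * (w \<bullet> u)"
  by (simp add: sum_shift_7[of _ 0] inner_shift_7[of _ _ 0] cross_nth axis_def)

lemma trace_cross_cross_left: "(\<Sum>i\<in>UNIV. cross (cross (axis i 1) w) u $ i) = - 6 * (w \<bullet> u)"
  by (simp add: sum_shift_7[of _ 0] inner_shift_7[of _ _ 0] cross_nth axis_def)

section \<open>Block matrices\<close>

text \<open>For skew \<open>B\<close> this is the general element of so(1,7), with rotation
  \<open>B\<close> and boost \<open>w\<close>; the border is symmetric because \<open>eta\<close>
  has opposite signs there.\<close>

definition blk :: "real^7^7 \<Rightarrow> real^7 \<Rightarrow> mat8" where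
  "blk B w = (\<chi> i j. case i of
      None \<Rightarrow> (case j of None \<Rightarrow> 0 | Some b \<Rightarrow> w $ b)
    | Some a \<Rightarrow> (case j of None \<Rightarrow> w $ a | Some b \<Rightarrow> B $ a $ b))"

definition wedge :: "real^7 \<Rightarrow> real^7 \<Rightarrow> real^7^7" where
  "wedge v w = (\<chi> i j. v $ i * w $ j - w $ i * v $ j)"

text \<open>Imaginary part of left multiplication by \<open>v\<close>; these matrices will form the
  complement of g2 in so(7).\<close>

definition amat :: "real^7 \<Rightarrow> real^7^7" where
  "amat v = (\<chi> i j. cross v (axis j 1) $ i)"

text \<open>The orthogonal projection of \<open>wedge v w\<close> to \<open>\<gg>\<^sub>2\<close>.\<close>

definition dmat :: "real^7 \<Rightarrow> real^7 \<Rightarrow> real^7^7" where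
  "dmat v w = wedge v w + (1/3) *\<^sub>R amat (cross v w)"

definition skew :: "real^7^7 \<Rightarrow> bool" where
  "skew B \<longleftrightarrow> transpose B = - B"

text \<open>Seven linear equations cutting the 14-dimensional g2 out of the 21-dimensional so(7);
  the \<open>k\<close>-th runs over the three pairs of units with product
  \<open>e_k\<close>.\<close>

definition g2mat :: "real^7^7 \<Rightarrow> bool" where
  "g2mat B \<longleftrightarrow> skew B \<and>
     (\<forall>k. B $ (k+1) $ (k+3) + B $ (k+2) $ (k+6) + B $ (k+4) $ (k+5) = 0)"

lemma sum_option:
  fixes f :: "'a::finite option \<Rightarrow> 'b::comm_monoid_add"
  shows "(\<Sum>i\<in>UNIV. f i) = f None + (\<Sum>i\<in>UNIV. f (Some i))"
  by (simp add: UNIV_option_conv sum.reindex)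

lemma skew_nth: "skew B \<longleftrightarrow> (\<forall>i j. B $ j $ i = - B $ i $ j)"
  by (auto simp: skew_def transpose_def vec_eq_iff)

lemma blk_nth [simp]:
  "blk B w $ None $ None = 0" "blk B w $ None $ Some b = w $ b"
  "blk B w $ Some a $ None = w $ a" "blk B w $ Some a $ Some b = B $ a $ b"
  by (simp_all add: blk_def)

lemma blk_eq_iff [simp]: "blk B w = blk B' w' \<longleftrightarrow> B = B' \<and> w = w'"
  by (metis (no_types, lifting) blk_nth vec_eq_iff)

lemma mat8_eqI:
  assumes "A $ None $ None = A' $ None $ None" "\<And>j. A $ None $ Some j = A' $ None $ Some j"
    "\<And>i. A $ Some i $ None = A' $ Some i $ None" "\<And>i j. A $ Some i $ Some j = A' $ Some i $ Some j"
  shows "A = (A' :: mat8)"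
  unfolding vec_eq_iff by (metis assms not_Some_eq)

lemma blk_add: "blk B w + blk B' w' = blk (B + B') (w + w')"
  and blk_diff: "blk B w - blk B' w' = blk (B - B') (w - w')"
  and blk_minus: "- blk B w = blk (- B) (- w)"
  and blk_scaleR: "c *\<^sub>R blk B w = blk (c *\<^sub>R B) (c *\<^sub>R w)"
  and blk_zero: "blk 0 0 = 0"
  by (rule mat8_eqI; simp)+

lemma sum_blk: "(\<Sum>i\<in>I. blk (B i) (w i)) = blk (\<Sum>i\<in>I. B i) (\<Sum>i\<in>I. w i)"
  by (induction I rule: infinite_finite_induct) (simp_all add: blk_zero blk_add)

lemma lie_blk:
  assumes "skew B" "skew B'"
  shows "lie (blk B w) (blk B' w') =
    blk (B ** B' - B' ** B + wedge w w') (B *v w' - B' *v w)"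
proof (rule mat8_eqI)
  have *: "B $ j $ i = - B $ i $ j" "B' $ j $ i = - B' $ i $ j" for i j
    using assms unfolding skew_nth by blast+
  fix i j
  show "lie (blk B w) (blk B' w') $ None $ Some j =
    blk (B ** B' - B' ** B + wedge w w') (B *v w' - B' *v w) $ None $ Some j"
    by (simp add: lie_def matrix_matrix_mult_def matrix_vector_mult_def sum_option
        *[of _ j] sum_negf mult.commute)
qed (simp_all add: lie_def matrix_matrix_mult_def matrix_vector_mult_def sum_option wedge_def
      mult.commute)

lemma skew_zero [simp]: "skew 0"
  and skew_wedge [simp]: "skew (wedge v w)"
  by (simp_all add: skew_nth wedge_def)

lemma skew_lincomb:
  assumes "skew B" "skew B'" shows "skew (c *\<^sub>R B + c' *\<^sub>R B')"
proof -
  have *: "B $ j $ i = - B $ i $ j" "B' $ j $ i = - B' $ i $ j" for i j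
    using assms unfolding skew_nth by blast+
  have "(c *\<^sub>R B + c' *\<^sub>R B') $ j $ i = - (c *\<^sub>R B + c' *\<^sub>R B') $ i $ j" for i j
    using *[of j i] by (simp add: algebra_simps)
  then show ?thesis unfolding skew_nth by blast
qed

lemma skew_add: "skew B \<Longrightarrow> skew B' \<Longrightarrow> skew (B + B')"
  and skew_diff: "skew B \<Longrightarrow> skew B' \<Longrightarrow> skew (B - B')"
  and skew_scaleR: "skew B \<Longrightarrow> skew (c *\<^sub>R B)"
  using skew_lincomb[of B B' 1 1] skew_lincomb[of B B' 1 "-1"] skew_lincomb[of B 0 c 0] by simp_all

lemma amat_nth: "amat v $ i $ j =
    (if j = i+3 then v$(i+1) else 0) - (if j = i+1 then v$(i+3) else 0)
  + (if j = i+6 then v$(i+2) else 0) - (if j = i+2 then v$(i+6) else 0)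
  + (if j = i+5 then v$(i+4) else 0) - (if j = i+4 then v$(i+5) else 0)"
  by (auto simp: amat_def cross_nth axis_def)

lemma skew_amat [simp]: "skew (amat v)"
  unfolding skew_nth
proof (intro allI)
  fix i j :: 7
  show "amat v $ j $ i = - amat v $ i $ j"
    by (rule shift_7_cases[of j i]) (simp_all add: amat_nth add.assoc)
qed

lemma amat_mult [simp]: "amat v *v u = cross v u"
proof -
  have "(amat v *v u) $ k = cross v u $ k" for k
    by (simp add: matrix_vector_mult_def amat_def cross_nth sum_shift_7[of _ k] axis_def
        add.assoc algebra_simps)
  then show ?thesis by (simp add: vec_eq_iff)
qed

lemma wedge_mult [simp]: "wedge v w *v u = (w \<bullet> u) *\<^sub>R v - (v \<bullet> u) *\<^sub>R w"
  by (simp add: vec_eq_iff wedge_def matrix_vector_mult_def inner_vec_def algebra_simps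
      sum_subtractf sum_distrib_left)

lemma amat_add: "amat (v + w) = amat v + amat w"
  and amat_diff: "amat (v - w) = amat v - amat w"
  and amat_minus: "amat (- v) = - amat v"
  and amat_scaleR: "amat (c *\<^sub>R v) = c *\<^sub>R amat v"
  and amat_zero [simp]: "amat 0 = 0"
  by (simp_all add: vec_eq_iff amat_def cross_linear)

lemma amat_eq_iff [simp]: "amat v = amat w \<longleftrightarrow> v = w"
proof
  assume eq: "amat v = amat w"
  have "v $ (i+1) = w $ (i+1)" for i
    using arg_cong[OF eq, of "\<lambda>M. M $ i $ (i+3)"] by (simp add: amat_nth)
  from this[of "_ - 1"] show "v = w" by (simp add: vec_eq_iff)
qed simp

section \<open>g2 as a linear space of matrices and as the derivations of the cross product\<close>

lemma g2matD:
  assumes "g2mat B" shows "skew B"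
    and "B $ (k+1) $ (k+3) + B $ (k+2) $ (k+6) + B $ (k+4) $ (k+5) = 0"
  using assms by (simp_all add: g2mat_def)

lemma g2mat_zero [simp]: "g2mat 0"
  by (simp add: g2mat_def)

lemma g2mat_lincomb:
  assumes "g2mat B" "g2mat B'" shows "g2mat (c *\<^sub>R B + c' *\<^sub>R B')"
proof -
  let ?M = "c *\<^sub>R B + c' *\<^sub>R B'"
  have "?M $ (k+1) $ (k+3) + ?M $ (k+2) $ (k+6) + ?M $ (k+4) $ (k+5) =
      c * (B $ (k+1) $ (k+3) + B $ (k+2) $ (k+6) + B $ (k+4) $ (k+5))
    + c' * (B' $ (k+1) $ (k+3) + B' $ (k+2) $ (k+6) + B' $ (k+4) $ (k+5))" for k
    by (simp add: algebra_simps)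
  then show ?thesis
    using assms by (simp add: g2mat_def skew_lincomb)
qed

lemma g2mat_diff: "g2mat B \<Longrightarrow> g2mat B' \<Longrightarrow> g2mat (B - B')"
  and g2mat_scaleR: "g2mat B \<Longrightarrow> g2mat (c *\<^sub>R B)"
  using g2mat_lincomb[of B B' 1 "-1"]
    g2mat_lincomb[of B 0 c 0] by simp_all

lemma g2mat_dmat [simp]: "g2mat (dmat v w)"
  unfolding g2mat_def
proof
  show "\<forall>k. dmat v w $ (k+1) $ (k+3) + dmat v w $ (k+2) $ (k+6) + dmat v w $ (k+4) $ (k+5) = 0"
    by (simp add: dmat_def wedge_def amat_nth cross_nth add.assoc algebra_simps)
qed (simp add: dmat_def skew_add skew_scaleR)

lemma amat_commutator:
  "amat v ** amat w - amat w ** amat v = - amat (cross v w) - 3 *\<^sub>R dmat v w"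
  unfolding matrix_eq
proof
  fix u
  show "(amat v ** amat w - amat w ** amat v) *v u = (- amat (cross v w) - 3 *\<^sub>R dmat v w) *v u"
    using cross_commutator[of v w u]
    by (simp add: matrix_vector_mult_diff_rdistrib matrix_vector_mult_add_rdistrib
        dmat_def matrix_vector_mul_assoc[symmetric] algebra_simps
        cross_minus_left scaleR_2 flip: scaleR_matrix_vector_assoc amat_minus)
qed

lemma wedge_eq_dmat: "wedge v w = dmat v w - (1/3) *\<^sub>R amat (cross v w)"
  by (simp add: dmat_def)

text \<open>Skewness and the seven equations express all of \<open>B\<close> through the 14 entries
  at positions \<open>(j, j+1)\<close> and \<open>(j, j+3)\<close>. With these independent
  coordinates the Leibniz rule becomes a plain polynomial identity.\<close>

lemma g2mat_mult_nth:
  assumes "g2mat B"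
  shows "(B *v u) $ i = B$i$(i+1) * u$(i+1) + (B$(i+5)$(i+1) - B$(i+3)$(i+4)) * u$(i+2)
     + B$i$(i+3) * u$(i+3) - B$(i+4)$i * u$(i+4)
     + (B$(i+1)$(i+2) - B$(i+3)$(i+6)) * u$(i+5) - B$(i+6)$i * u$(i+6)"
proof -
  have sk: "B $ j $ i = - B $ i $ j" for i j
    using g2matD(1)[OF assms] unfolding skew_nth by blast
  have "B$i$i = 0" using sk[of i i] by simp
  moreover have "B$i$(i+2) = B$(i+5)$(i+1) - B$(i+3)$(i+4)"
    using g2matD(2)[OF assms, of "i+6"] sk[of "i+1" "i+5"] by (simp add: add.assoc)
  moreover have "B$i$(i+5) = B$(i+1)$(i+2) - B$(i+3)$(i+6)"
    using g2matD(2)[OF assms, of "i+4"] sk[of i "i+5"] sk[of "i+6" "i+3"] by (simp add: add.assoc)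
  moreover have "B$i$(i+4) = - B$(i+4)$i" "B$i$(i+6) = - B$(i+6)$i"
    by (rule sk)+
  ultimately show ?thesis
    by (simp add: matrix_vector_mult_def sum_shift_7[of _ i])
qed

lemma g2mat_derivation:
  assumes "g2mat B"
  shows "B *v cross v w = cross (B *v v) w + cross v (B *v w)"
proof -
  have "(B *v cross v w) $ k = (cross (B *v v) w + cross v (B *v w)) $ k" for k
    by (simp only: g2mat_mult_nth[OF assms] cross_nth vector_add_component)
      (simp add: add.assoc, simp add: algebra_simps)
  then show ?thesis by (simp add: vec_eq_iff)
qed

lemma derivation_g2mat:
  assumes "skew B" and "\<And>v w. B *v cross v w = cross (B *v v) w + cross v (B *v w)"
  shows "g2mat B"
  unfolding g2mat_def
proof (intro conjI allI)
  fix k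
  have sk: "B $ j $ i = - B $ i $ j" for i j
    using assms(1) unfolding skew_nth by blast
  \<comment> \<open>Since \<open>e_{k+2} x e_{k+4} = e_{k+1}\<close>, the coefficient of
    \<open>e_{k+3}\<close> in the Leibniz rule for this product is the required equation.\<close>
  show "B $ (k+1) $ (k+3) + B $ (k+2) $ (k+6) + B $ (k+4) $ (k+5) = 0"
    using arg_cong[OF assms(2)[of "axis (k+2) 1" "axis (k+4) 1"], of "\<lambda>u. u $ (k+3)"]
    by (simp add: matrix_vector_mult_def cross_nth sum_shift_7[of _ k] axis_def add.assoc
        sk[of "k+3" "k+1"] sk[of "k+2" "k+6"] sk[of "k+4" "k+5"])
qed fact

section \<open>Traces and Killing forms\<close>

lemma linear_map_on_sum:
  assumes "linear_map_on V f" "subspace V" "\<And>i. i \<in> I \<Longrightarrow> b i \<in> V"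
  shows "f (\<Sum>i\<in>I. c i *\<^sub>R b i) = (\<Sum>i\<in>I. c i *\<^sub>R f (b i))"
proof -
  have 0: "f 0 = 0"
    using assms(1,2) subspace_0[of V] unfolding linear_map_on_def
    by (metis scaleR_zero_left)
  have "(\<forall>i\<in>I. b i \<in> V) \<longrightarrow> f (\<Sum>i\<in>I. c i *\<^sub>R b i) = (\<Sum>i\<in>I. c i *\<^sub>R f (b i))"
  proof (induction I rule: infinite_finite_induct)
    case (insert x F)
    then show ?case
      using assms(1,2) unfolding linear_map_on_def
      by (auto simp: subspace_sum subspace_scale)
  qed (simp_all add: 0)
  then show ?thesis using assms(3) by blast
qed

text \<open>No independence of the spanning family is needed: the identity of \<open>V\<close> factors through
  the coordinates \<open>\<phi>\<close>, and the trace is cyclic.\<close>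

lemma trace_on_frame:
  fixes V :: "'a::euclidean_space set"
  assumes V: "subspace V" and f: "linear_map_on V f" "f ` V \<subseteq> V"
    and b: "\<And>i. i \<in> I \<Longrightarrow> b i \<in> V"
    and \<phi>: "\<And>i. i \<in> I \<Longrightarrow> linear_map_on V (\<phi> i)"
    and frame: "\<And>X. X \<in> V \<Longrightarrow> X = (\<Sum>i\<in>I. \<phi> i X *\<^sub>R b i)"
  shows "trace_on V f = (\<Sum>i\<in>I. \<phi> i (f (b i)))"
proof -
  define B where "B = (SOME B. independent B \<and> span B = V)"
  have "\<exists>B. independent B \<and> span B = V"
    by (metis V basis_exists span_eq_iff span_mono subset_antisym)
  then have B: "independent B" "span B = V"
    unfolding B_def by (metis (mono_tags, lifting) someI_ex)+
  have fin: "finite B" using B(1) independent_imp_finite by blast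
  have BV: "c \<in> V" if "c \<in> B" for c using that B(2) span_base by blast
  have fV: "f X \<in> V" if "X \<in> V" for X using f(2) that by blast
  have "trace_on V f = (\<Sum>c\<in>B. representation B (f c) c)"
    unfolding trace_on_def B_def[symmetric] Let_def ..
  also have "\<dots> = (\<Sum>c\<in>B. \<Sum>i\<in>I. \<phi> i c * representation B (f (b i)) c)"
  proof (rule sum.cong[OF refl])
    fix c assume "c \<in> B"
    have "f c = f (\<Sum>i\<in>I. \<phi> i c *\<^sub>R b i)"
      using frame[OF BV[OF \<open>c \<in> B\<close>]] by simp
    also have "\<dots> = (\<Sum>i\<in>I. \<phi> i c *\<^sub>R f (b i))"
      by (rule linear_map_on_sum[OF f(1) V b])
    finally have "f c = (\<Sum>i\<in>I. \<phi> i c *\<^sub>R f (b i))" .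
    moreover have "representation B (\<Sum>i\<in>I. \<phi> i c *\<^sub>R f (b i)) =
        (\<lambda>d. \<Sum>i\<in>I. representation B (\<phi> i c *\<^sub>R f (b i)) d)"
      by (rule representation_sum[OF B(1)]) (simp add: B(2) V b fV subspace_scale)
    ultimately show "representation B (f c) c = (\<Sum>i\<in>I. \<phi> i c * representation B (f (b i)) c)"
      using B b fV by (simp add: representation_scale cong: sum.cong)
  qed
  also have "\<dots> = (\<Sum>i\<in>I. \<Sum>c\<in>B. representation B (f (b i)) c * \<phi> i c)"
    by (subst sum.swap) (simp add: mult.commute)
  also have "\<dots> = (\<Sum>i\<in>I. \<phi> i (f (b i)))"
  proof (rule sum.cong[OF refl])
    fix i assume i: "i \<in> I"
    have "f (b i) = (\<Sum>c\<in>B. representation B (f (b i)) c *\<^sub>R c)"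
      using sum_representation_eq[OF B(1) _ fin order_refl] B(2) fV b i by simp
    then have "\<phi> i (f (b i)) = \<phi> i (\<Sum>c\<in>B. representation B (f (b i)) c *\<^sub>R c)"
      by simp
    also have "\<dots> = (\<Sum>c\<in>B. representation B (f (b i)) c *\<^sub>R \<phi> i c)"
      by (rule linear_map_on_sum[OF \<phi>[OF i] V BV])
    finally show "(\<Sum>c\<in>B. representation B (f (b i)) c * \<phi> i c) = \<phi> i (f (b i))"
      by simp
  qed
  finally show ?thesis .
qed

section \<open>so(1,7), so(7), p_2 and g2 in block form\<close>

lemma so17_iff: "A \<in> so17 \<longleftrightarrow> (\<exists>B w. skew B \<and> A = blk B w)"
proof -
  define e :: "7 option \<Rightarrow> real" where "e i = (if i = None then -1 else 1)" for i
  have "A \<in> so17 \<longleftrightarrow> (\<forall>i j. A $ j $ i * e j + e i * A $ i $ j = 0)"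
    by (simp add: so17_def eta_def vec_eq_iff matrix_matrix_mult_def transpose_def e_def
        if_distrib[of "\<lambda>x. x * _"] if_distrib[of "\<lambda>x. _ * x"] sum.delta cong: if_cong)
  also have "\<dots> \<longleftrightarrow> A $ None $ None = 0 \<and> (\<forall>i. A $ None $ Some i = A $ Some i $ None)
      \<and> (\<forall>i j. A $ Some j $ Some i = - A $ Some i $ Some j)"
  proof
    assume *: "\<forall>i j. A $ j $ i * e j + e i * A $ i $ j = 0"
    have "A $ None $ None = 0" using *[rule_format, of None None] by (simp add: e_def)
    moreover have "A $ None $ Some i = A $ Some i $ None" for i
      using *[rule_format, of "Some i" None] by (simp add: e_def)
    moreover have "A $ Some j $ Some i = - A $ Some i $ Some j" for i j
      using *[rule_format, of "Some i" "Some j"] by (simp add: e_def)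
    ultimately show "A $ None $ None = 0 \<and> (\<forall>i. A $ None $ Some i = A $ Some i $ None)
      \<and> (\<forall>i j. A $ Some j $ Some i = - A $ Some i $ Some j)" by blast
  next
    assume *: "A $ None $ None = 0 \<and> (\<forall>i. A $ None $ Some i = A $ Some i $ None)
      \<and> (\<forall>i j. A $ Some j $ Some i = - A $ Some i $ Some j)"
    have "A $ j $ i * e j + e i * A $ i $ j = 0" for i j
    proof (cases i; cases j)
      fix a b assume "i = Some a" "j = Some b"
      then show ?thesis using *[THEN conjunct2, THEN conjunct2, rule_format, of b a]
        by (simp only: e_def) simp
    qed (use *[THEN conjunct1] *[THEN conjunct2, THEN conjunct1] in \<open>simp_all add: e_def\<close>)
    then show "\<forall>i j. A $ j $ i * e j + e i * A $ i $ j = 0" by blast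
  qed
  also have "\<dots> \<longleftrightarrow> (\<exists>B w. skew B \<and> A = blk B w)"
  proof safe
    assume *: "A $ None $ None = 0" "\<forall>i. A $ None $ Some i = A $ Some i $ None"
      "\<forall>i j. A $ Some j $ Some i = - A $ Some i $ Some j"
    have "A = blk (\<chi> i j. A $ Some i $ Some j) (\<chi> i. A $ Some i $ None)"
      using *(1,2) by (intro mat8_eqI) simp_all
    moreover have "skew (\<chi> i j. A $ Some i $ Some j)"
      unfolding skew_nth vec_lambda_beta by (fact *(3))
    ultimately show "\<exists>B w. skew B \<and> A = blk B w" by blast
  next
    fix B w i j assume "skew B"
    then show "blk B w $ Some j $ Some i = - blk B w $ Some i $ Some j"
      unfolding skew_nth blk_nth by blast
  qed simp_all
  finally show ?thesis .
qed

lemma transpose_blk: "transpose (blk B w) = blk (transpose B) w"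
  by (rule mat8_eqI) (simp_all add: transpose_def)

lemma so7_iff: "A \<in> so7 \<longleftrightarrow> (\<exists>B. skew B \<and> A = blk B 0)"
proof
  assume "A \<in> so7"
  then obtain B w where *: "skew B" "A = blk B w" "transpose A = - A"
    unfolding so7_def so17_iff by blast
  have "w = - w" using *(3) unfolding *(2) transpose_blk blk_minus blk_eq_iff by simp
  then have "(1 + 1) *\<^sub>R w = 0" unfolding scaleR_left_distrib by (metis add.right_inverse scaleR_one)
  then have "w = 0" by simp
  then show "\<exists>B. skew B \<and> A = blk B 0" using * by auto
next
  assume "\<exists>B. skew B \<and> A = blk B 0"
  then obtain B where *: "skew B" "A = blk B 0" by blast
  have "transpose A = - A"
    using *(1) unfolding *(2) transpose_blk blk_minus skew_def by simp
  then show "A \<in> so7" unfolding so7_def so17_iff using * by blast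
qed

lemma p2_iff: "A \<in> p2 \<longleftrightarrow> (\<exists>w. A = blk 0 w)"
proof
  assume "A \<in> p2"
  then obtain B w where *: "skew B" "A = blk B w" "transpose A = A"
    unfolding p2_def so17_iff by blast
  have "- B = B" using *(1,3) unfolding *(2) transpose_blk blk_eq_iff skew_def by simp
  then have "(1 + 1) *\<^sub>R B = 0" unfolding scaleR_left_distrib by (metis ab_left_minus scaleR_one)
  then have "B = 0" by simp
  then show "\<exists>w. A = blk 0 w" using * by blast
next
  assume "\<exists>w. A = blk 0 w"
  then obtain w where *: "A = blk 0 w" by blast
  have "transpose A = A"
    unfolding * transpose_blk blk_eq_iff by (simp add: transpose_def vec_eq_iff)
  then show "A \<in> p2" unfolding p2_def so17_iff using * skew_zero by blast
qed

lemma oct_mult_nth [simp]: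
  "oct_mult x y $ None = x $ None * y $ None - (\<chi> i. x $ Some i) \<bullet> (\<chi> i. y $ Some i)"
  "oct_mult x y $ Some k = x $ None * y $ Some k + x $ Some k * y $ None
     + cross (\<chi> i. x $ Some i) (\<chi> i. y $ Some i) $ k"
  by (simp_all add: oct_mult_def inner_vec_def cross_nth)

lemma blk_mult_vec [simp]:
  "(blk B w *v x) $ None = w \<bullet> (\<chi> i. x $ Some i)"
  "(blk B w *v x) $ Some k = w $ k * x $ None + (B *v (\<chi> i. x $ Some i)) $ k"
  by (simp_all add: matrix_vector_mult_def sum_option inner_vec_def)

lemma skew_inner:
  assumes "skew B" shows "(B *v v) \<bullet> w = - (v \<bullet> (B *v w))"
proof -
  have "v v* B = (0 - B) *v v"
    using assms by (simp add: skew_def flip: transpose_matrix_vector)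
  then have "B *v v = - (v v* B)"
    by (simp only: matrix_vector_mult_diff_rdistrib) simp
  then show ?thesis by (simp add: dot_lmul_matrix)
qed

text \<open>An element of so(7) kills the octonion unit and is skew on the imaginary part, which
  settles products with the unit and the real part of the Leibniz rule. What remains is the rule for
  \<open>cross\<close>.\<close>

lemma g2_iff: "A \<in> g2 \<longleftrightarrow> (\<exists>B. g2mat B \<and> A = blk B 0)"
proof
  assume "A \<in> g2"
  then obtain B where B: "skew B" "A = blk B 0"
    and der: "\<And>x y. A *v oct_mult x y = oct_mult (A *v x) y + oct_mult x (A *v y)"
    unfolding g2_def so7_iff by blast
  have "B *v cross v w = cross (B *v v) w + cross v (B *v w)" for v w
  proof -
    define e :: "real^7 \<Rightarrow> real^(7 option)"
      where "e u = (\<chi> i. case i of None \<Rightarrow> 0 | Some k \<Rightarrow> u $ k)" for u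
    have [simp]: "e u $ None = 0" "e u $ Some k = u $ k" "(\<chi> i. e u $ Some i) = u" for u k
      by (simp_all add: e_def vec_eq_iff)
    have "(B *v cross v w) $ k = (cross (B *v v) w + cross v (B *v w)) $ k" for k
      using arg_cong[OF der[of "e v" "e w"], of "\<lambda>u. u $ Some k"] by (simp add: B(2))
    then show ?thesis by (simp add: vec_eq_iff)
  qed
  then show "\<exists>B. g2mat B \<and> A = blk B 0" using derivation_g2mat B by blast
next
  assume "\<exists>B. g2mat B \<and> A = blk B 0"
  then obtain B where B: "g2mat B" "A = blk B 0" by blast
  have sk: "skew B" using g2matD(1)[OF B(1)] .
  have "A *v oct_mult x y = oct_mult (A *v x) y + oct_mult x (A *v y)" for x y
  proof -
    let ?i = "\<lambda>x::real^(7 option). \<chi> i. x $ Some i"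
    have 1: "?i (oct_mult x y) = (x $ None) *\<^sub>R ?i y + (y $ None) *\<^sub>R ?i x + cross (?i x) (?i y)"
      for x y by (simp add: vec_eq_iff)
    have 2: "?i (A *v x) = B *v ?i x" for x by (simp add: vec_eq_iff B(2))
    have "(A *v oct_mult x y) $ j = (oct_mult (A *v x) y + oct_mult x (A *v y)) $ j" for j
    proof (cases j)
      case None
      then show ?thesis
        using skew_inner[OF sk, of "?i x" "?i y"]
        by (simp add: 2) (simp add: B(2))
    next
      case (Some k)
      have "(A *v oct_mult x y) $ j = (B *v ?i (oct_mult x y)) $ k"
        by (simp add: B(2) Some)
      also have "\<dots> = x $ None * (B *v ?i y) $ k + y $ None * (B *v ?i x) $ k
          + (cross (B *v ?i x) (?i y) + cross (?i x) (B *v ?i y)) $ k"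
        unfolding 1 by (simp add: matrix_vector_right_distrib matrix_vector_mult_scaleR
            g2mat_derivation[OF B(1)])
      also have "\<dots> = (oct_mult (A *v x) y + oct_mult x (A *v y)) $ j"
        by (simp add: Some 2) (simp add: B(2))
      finally show ?thesis .
    qed
    then show ?thesis by (simp add: vec_eq_iff)
  qed
  moreover have "A \<in> so7" using so7_iff sk B(2) by blast
  ultimately show "A \<in> g2" by (simp add: g2_def)
qed

lemma sum_axis_nth [simp]: "(\<Sum>i\<in>UNIV. f i * axis i (1::real) $ (j::7)) = f j"
  "(\<Sum>i\<in>UNIV. axis i (1::real) $ j * f i) = f j"
  "(\<Sum>i\<in>UNIV. f i * axis j (1::real) $ (i::7)) = f j"
  "(\<Sum>i\<in>UNIV. axis j (1::real) $ i * f i) = f j"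
proof -
  have "f i * axis i 1 $ j = (if i = j then f i else 0)" "axis i 1 $ j * f i = (if i = j then f i else 0)"
    "f i * axis j 1 $ i = (if i = j then f i else 0)" "axis j 1 $ i * f i = (if i = j then f i else 0)" for i
    by (simp_all add: axis_def)
  then show "(\<Sum>i\<in>UNIV. f i * axis i (1::real) $ (j::7)) = f j"
    "(\<Sum>i\<in>UNIV. axis i (1::real) $ j * f i) = f j"
    "(\<Sum>i\<in>UNIV. f i * axis j (1::real) $ (i::7)) = f j"
    "(\<Sum>i\<in>UNIV. axis j (1::real) $ i * f i) = f j"
    by simp_all
qed

lemma so17I: "skew B \<Longrightarrow> blk B w \<in> so17" using so17_iff by blast

lemma so7I: "skew B \<Longrightarrow> blk B 0 \<in> so7" using so7_iff by blast

lemma so17E: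
  assumes "A \<in> so17" obtains B w where "skew B" "A = blk B w"
  using assms so17_iff by blast

lemma so7E:
  assumes "A \<in> so7" obtains B where "skew B" "A = blk B 0"
  using assms so7_iff by blast

lemma subspace_so17: "subspace so17"
proof (rule subspaceI)
  show "0 \<in> so17" using so17I[OF skew_zero, of 0] by (simp add: blk_zero)
qed (auto elim!: so17E simp: blk_add blk_scaleR intro!: so17I skew_add skew_scaleR)

lemma subspace_so7: "subspace so7"
proof (rule subspaceI)
  show "0 \<in> so7" using so7I[OF skew_zero] by (simp add: blk_zero)
qed (auto elim!: so7E simp: blk_add blk_scaleR intro!: so7I skew_add skew_scaleR)

lemma lie_add_right: "lie X (A + B) = lie X A + lie X B"
  and lie_scaleR_right: "lie X (c *\<^sub>R A) = c *\<^sub>R lie X A"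
  by (simp_all add: lie_def vec_eq_iff matrix_matrix_mult_def sum.distrib
      sum_distrib_left sum_subtractf algebra_simps)

lemma linear_map_on_lie_lie: "linear_map_on V (\<lambda>Z. lie X (lie Y Z))"
  by (simp add: linear_map_on_def lie_add_right lie_scaleR_right)

lemma skew_commutator:
  assumes "skew B" "skew C" shows "skew (B ** C - C ** B)"
proof -
  have *: "transpose (B ** C) = C ** B" if "skew B" "skew C" for B C
    unfolding matrix_transpose_mul using that
    by (simp add: skew_def) (simp add: matrix_matrix_mult_def)
  have "transpose (B ** C - C ** B) = transpose (B ** C) - transpose (C ** B)"
    by (simp add: transpose_def vec_eq_iff)
  then show ?thesis unfolding skew_def using assms by (simp add: *)
qed

lemma lie_so17: "A \<in> so17 \<Longrightarrow> A' \<in> so17 \<Longrightarrow> lie A A' \<in> so17"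
  by (elim so17E) (simp add: lie_blk so17I skew_add skew_commutator)

lemma lie_so7:
  assumes "A \<in> so7" "A' \<in> so7" shows "lie A A' \<in> so7"
proof -
  have "wedge 0 0 = 0" by (simp add: wedge_def vec_eq_iff)
  then show ?thesis using assms by (elim so7E) (simp add: lie_blk so7I skew_commutator)
qed

section \<open>Killing forms of so(7) and so(1,7)\<close>

lemma wedge_scaleR_left: "wedge (c *\<^sub>R v) w = c *\<^sub>R wedge v w"
  and wedge_minus_right: "wedge v (- w) = - wedge v w"
  and wedge_zero [simp]: "wedge 0 w = 0" "wedge v 0 = 0"
  by (simp_all add: wedge_def vec_eq_iff algebra_simps)

text \<open>Under the identification of so(7) with the second exterior power of the vector
  representation, the adjoint action is the induced one; traces of \<open>ad\<close> thus reduce to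
  sums over vectors.\<close>

lemma commutator_wedge:
  assumes "skew B"
  shows "B ** wedge u v - wedge u v ** B = wedge (B *v u) v + wedge u (B *v v)"
  unfolding matrix_eq
proof
  fix x
  show "(B ** wedge u v - wedge u v ** B) *v x = (wedge (B *v u) v + wedge u (B *v v)) *v x"
    using skew_inner[OF assms]
    by (simp add: algebra_simps matrix_vector_mult_scaleR flip: matrix_vector_mul_assoc)
qed

text \<open>Ordered pairs \<open>(i, j)\<close> count each plane twice, whence the 1/2. This
  spanning family is redundant, which \<open>trace_on_frame\<close> permits, and no ordering of the
  indices has to be chosen.\<close>

lemma skew_expansion:
  assumes "skew B"
  shows "(\<Sum>i\<in>UNIV. \<Sum>j\<in>UNIV. B $ i $ j *\<^sub>R (1/2) *\<^sub>R wedge (axis i 1) (axis j 1)) = B"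
proof -
  have "(\<Sum>i\<in>UNIV. \<Sum>j\<in>UNIV. B $ i $ j *\<^sub>R (1/2) *\<^sub>R wedge (axis i 1) (axis j 1)) $ k $ l
    = (1/2) * (B $ k $ l - B $ l $ k)" for k l
  proof -
    have "(\<Sum>i\<in>UNIV. \<Sum>j\<in>UNIV. B $ i $ j *\<^sub>R (1/2) *\<^sub>R wedge (axis i 1) (axis j 1)) $ k $ l
      = (1/2) * ((\<Sum>i\<in>UNIV. (\<Sum>j\<in>UNIV. B $ i $ j * axis j 1 $ l) * axis i 1 $ k)
               - (\<Sum>i\<in>UNIV. (\<Sum>j\<in>UNIV. B $ i $ j * axis j 1 $ k) * axis i 1 $ l))"
      by (simp only: sum_component sum_distrib_left sum_distrib_right sum_subtractf[symmetric])
        (simp add: wedge_def algebra_simps)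
    then show ?thesis by simp
  qed
  moreover have "(1/2) * (B $ k $ l - B $ l $ k) = B $ k $ l" for k l
    using assms[unfolded skew_nth, rule_format, of l k] by simp
  ultimately show ?thesis unfolding vec_eq_iff by presburger
qed

lemma inner_mat: "(B :: real^7^7) \<bullet> C = (\<Sum>i\<in>UNIV. \<Sum>j\<in>UNIV. B $ i $ j * C $ i $ j)"
  by (simp add: inner_vec_def)

lemma trace_on_so7:
  assumes f: "linear_map_on so7 f" "f ` so7 \<subseteq> so7"
  shows "trace_on so7 f =
    (\<Sum>i\<in>UNIV. \<Sum>j\<in>UNIV. f (blk ((1/2) *\<^sub>R wedge (axis i 1) (axis j 1)) 0) $ Some i $ Some j)"
proof -
  have "trace_on so7 f = (\<Sum>(i,j)\<in>UNIV\<times>UNIV. f (blk ((1/2) *\<^sub>R wedge (axis i 1) (axis j 1)) 0) $ Some i $ Some j)"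
    unfolding split_def
  proof (rule trace_on_frame[OF subspace_so7 f, where \<phi> = "\<lambda>p X. X $ Some (fst p) $ Some (snd p)"])
    fix X assume "X \<in> so7"
    then obtain B where B: "skew B" "X = blk B 0" unfolding so7_iff by blast
    have "(\<Sum>p\<in>UNIV \<times> UNIV. X $ Some (fst p) $ Some (snd p) *\<^sub>R
        blk ((1/2) *\<^sub>R wedge (axis (fst p) 1) (axis (snd p) 1)) 0) =
      blk (\<Sum>i\<in>UNIV. \<Sum>j\<in>UNIV. B $ i $ j *\<^sub>R (1/2) *\<^sub>R wedge (axis i 1) (axis j 1)) 0"
      by (simp add: B(2) blk_scaleR sum_blk sum.cartesian_product split_def)
    then show "X = (\<Sum>p\<in>UNIV \<times> UNIV. X $ Some (fst p) $ Some (snd p) *\<^sub>R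
        blk ((1/2) *\<^sub>R wedge (axis (fst p) 1) (axis (snd p) 1)) 0)"
      unfolding skew_expansion[OF B(1)] B(2) by simp
  qed (auto simp: linear_map_on_def so7_iff skew_scaleR)
  then show ?thesis by (simp add: sum.cartesian_product)
qed

lemma trace_on_so17:
  assumes f: "linear_map_on so17 f" "f ` so17 \<subseteq> so17"
  shows "trace_on so17 f =
    (\<Sum>i\<in>UNIV. \<Sum>j\<in>UNIV. f (blk ((1/2) *\<^sub>R wedge (axis i 1) (axis j 1)) 0) $ Some i $ Some j)
    + (\<Sum>i\<in>UNIV. f (blk 0 (axis i 1)) $ Some i $ None)"
proof -
  define b where "b p = (case p of Inl (i,j) \<Rightarrow> blk ((1/2) *\<^sub>R wedge (axis i 1) (axis j 1)) 0
      | Inr i \<Rightarrow> blk 0 (axis i 1))" for p :: "7 \<times> 7 + 7"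
  define \<phi> where "\<phi> p X = (case p of Inl (i,j) \<Rightarrow> X $ Some i $ Some j
      | Inr i \<Rightarrow> X $ Some i $ None)" for p :: "7 \<times> 7 + 7" and X :: mat8
  have sum_Plus: "(\<Sum>p\<in>UNIV. g p) = (\<Sum>i\<in>UNIV. \<Sum>j\<in>UNIV. g (Inl (i,j))) + (\<Sum>i\<in>UNIV. g (Inr i))"
    for g :: "7 \<times> 7 + 7 \<Rightarrow> 'z::comm_monoid_add"
    by (simp add: UNIV_Plus_UNIV[symmetric] sum.Plus sum.cartesian_product UNIV_Times_UNIV[symmetric]
        del: UNIV_Plus_UNIV UNIV_Times_UNIV)
  have "trace_on so17 f = (\<Sum>p\<in>UNIV. \<phi> p (f (b p)))"
  proof (rule trace_on_frame[OF subspace_so17 f])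
    fix p show "b p \<in> so17" "linear_map_on so17 (\<phi> p)"
      by (auto simp: b_def \<phi>_def so17_iff linear_map_on_def skew_scaleR split: sum.split)
  next
    fix X assume "X \<in> so17"
    then obtain B w where B: "skew B" "X = blk B w" unfolding so17_iff by blast
    show "X = (\<Sum>p\<in>UNIV. \<phi> p X *\<^sub>R b p)"
      unfolding sum_Plus b_def \<phi>_def
      by (simp add: B(2) blk_scaleR sum_blk blk_add skew_expansion[OF B(1), simplified]
        basis_expansion[of w, simplified scalar_mult_eq_scaleR])
  qed
  then show ?thesis by (simp add: sum_Plus b_def \<phi>_def)
qed

text \<open>On skew matrices \<open>tr (B C) = - B \<bullet> C\<close>.\<close>

lemma trace_wedge_ad_ad:
  assumes "skew B" "skew C"
  shows "(\<Sum>i\<in>UNIV. \<Sum>j\<in>UNIV. (wedge (B *v (C *v axis i 1)) (axis j 1) + wedge (C *v axis i 1) (B *v axis j 1)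
     + (wedge (B *v axis i 1) (C *v axis j 1) + wedge (axis i 1) (B *v (C *v axis j 1)))) $ i $ j)
    = - 10 * (B \<bullet> C)"
proof -
  have sk: "B $ j $ i = - B $ i $ j" "C $ j $ i = - C $ i $ j" for i j
    using assms unfolding skew_nth by blast+
  have d: "B $ i $ i = 0" "C $ i $ i = 0" for i using sk[of i i] by simp_all
  have col: "(M *v axis i 1) $ k = M $ k $ i" for M :: "real^7^7" and i k
    by (simp add: matrix_vector_mult_def)
  have col2: "(M *v (N *v axis i 1)) $ k = (\<Sum>j\<in>UNIV. M $ k $ j * N $ j $ i)" for M N :: "real^7^7" and i k
    by (simp add: matrix_vector_mult_def)
  have t: "(\<Sum>i\<in>UNIV. \<Sum>j\<in>UNIV. B $ i $ j * C $ j $ i) = - (B \<bullet> C)"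
    unfolding inner_mat sum_negf[symmetric] by (intro sum.cong refl) (metis sk(2) mult_minus_right)
  have t': "(\<Sum>i\<in>UNIV. \<Sum>j\<in>UNIV. C $ i $ j * B $ j $ i) = - (B \<bullet> C)"
    unfolding t[symmetric] by (subst sum.swap) (simp add: mult.commute)
  \<comment> \<open>The first and the last wedge contribute \<open>7 - 1 = 6\<close> times the trace
    of \<open>B C\<close> each; the two mixed ones contribute minus one trace each, because the
    diagonals vanish.\<close>
  have "(\<Sum>i\<in>UNIV. \<Sum>j\<in>UNIV. (wedge (B *v (C *v axis i 1)) (axis j 1) + wedge (C *v axis i 1) (B *v axis j 1)
     + (wedge (B *v axis i 1) (C *v axis j 1) + wedge (axis i 1) (B *v (C *v axis j 1)))) $ i $ j)
    = 12 * (\<Sum>i\<in>UNIV. \<Sum>j\<in>UNIV. B $ i $ j * C $ j $ i)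
     - (\<Sum>i\<in>UNIV. \<Sum>j\<in>UNIV. B $ i $ j * C $ j $ i) - (\<Sum>i\<in>UNIV. \<Sum>j\<in>UNIV. C $ i $ j * B $ j $ i)"
    by (simp add: wedge_def col2 col sum.distrib sum_subtractf d axis_nth sum_distrib_left[symmetric])
  then show ?thesis by (simp add: t t')
qed

lemma lie_blk_0:
  assumes "skew B" "skew C" shows "lie (blk B 0) (blk C 0) = blk (B ** C - C ** B) 0"
  using assms by (simp add: lie_blk)

lemma ad_half_wedge:
  assumes "skew B"
  shows "lie (blk B 0) (blk ((1/2) *\<^sub>R wedge u v) 0) =
    blk ((1/2) *\<^sub>R wedge (B *v u) v) 0 + blk ((1/2) *\<^sub>R wedge u (B *v v)) 0"
proof -
  have "lie (blk B 0) (blk ((1/2) *\<^sub>R wedge u v) 0) =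
      blk (B ** wedge ((1/2) *\<^sub>R u) v - wedge ((1/2) *\<^sub>R u) v ** B) 0"
    unfolding wedge_scaleR_left[symmetric] by (rule lie_blk_0) (simp_all add: assms)
  then show ?thesis
    unfolding commutator_wedge[OF assms]
    by (simp add: blk_add wedge_scaleR_left matrix_vector_mult_scaleR)
qed

lemma half_ad_ad_wedge:
  assumes "skew B" "skew C"
  shows "lie (blk B 0) (lie (blk C 0) (blk ((1/2) *\<^sub>R wedge u v) 0)) =
    blk ((1/2) *\<^sub>R (wedge (B *v (C *v u)) v + wedge (C *v u) (B *v v)
      + (wedge (B *v u) (C *v v) + wedge u (B *v (C *v v))))) 0"
  by (simp only: ad_half_wedge assms lie_add_right) (simp add: blk_add scaleR_add_right)

text \<open>The Killing form of so(n) is \<open>(n - 2) * tr (B C)\<close>; here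
  \<open>n = 7\<close>, and the trace of \<open>B C\<close> is
  \<open>- (B \<bullet> C)\<close>.\<close>

lemma killing_so7_blk:
  assumes "skew B" "skew C"
  shows "killing so7 (blk B 0) (blk C 0) = - 5 * (B \<bullet> C)"
proof -
  have "blk B 0 \<in> so7" "blk C 0 \<in> so7" using assms so7_iff by blast+
  then have "(\<lambda>Z. lie (blk B 0) (lie (blk C 0) Z)) ` so7 \<subseteq> so7" using lie_so7 by blast
  then show ?thesis
    using trace_wedge_ad_ad[OF assms]
    by (simp add: killing_def trace_on_so7 linear_map_on_lie_lie half_ad_ad_wedge assms
        sum_divide_distrib[symmetric])
qed

text \<open>Under so(7) the algebra so(1,7) splits into so(7) and the vector representation; the
  latter adds one more trace of \<open>B C\<close> to the factor 5.\<close>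

lemma killing_so17_blk_skew:
  assumes "skew B" "skew C"
  shows "killing so17 (blk B 0) (blk C 0) = - 6 * (B \<bullet> C)"
proof -
  have "blk B 0 \<in> so17" "blk C 0 \<in> so17" using assms so17_iff by blast+
  then have *: "(\<lambda>Z. lie (blk B 0) (lie (blk C 0) Z)) ` so17 \<subseteq> so17" using lie_so17 by blast
  have "C $ j $ i = - C $ i $ j" for i j using assms(2) unfolding skew_nth by blast
  then have "(\<Sum>i\<in>UNIV. \<Sum>j\<in>UNIV. B $ i $ j * C $ j $ i) = - (B \<bullet> C)"
    unfolding inner_mat sum_negf[symmetric] by (intro sum.cong refl) (metis mult_minus_right)
  moreover have "(\<Sum>i\<in>UNIV. (B *v (C *v axis i 1)) $ i) = (\<Sum>i\<in>UNIV. \<Sum>j\<in>UNIV. B $ i $ j * C $ j $ i)"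
    by (simp add: matrix_vector_mult_def)
  ultimately show ?thesis
    using trace_wedge_ad_ad[OF assms]
    by (simp add: killing_def trace_on_so17[OF linear_map_on_lie_lie *] half_ad_ad_wedge assms
        sum_divide_distrib[symmetric] lie_blk)
qed

text \<open>The double bracket preserves so(7) and p_2; each of them contributes 6 to the
  trace.\<close>

lemma killing_so17_blk_vec: "killing so17 (blk 0 v) (blk 0 w) = 12 * (v \<bullet> w)"
proof -
  have "blk 0 v \<in> so17" "blk 0 w \<in> so17" using so17_iff skew_zero by blast+
  then have *: "(\<lambda>Z. lie (blk 0 v) (lie (blk 0 w) Z)) ` so17 \<subseteq> so17" using lie_so17 by blast
  have ll: "lie (blk 0 v) (lie (blk 0 w) (blk C u)) = blk (- wedge v (C *v w)) ((w \<bullet> v) *\<^sub>R u - (u \<bullet> v) *\<^sub>R w)"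
    if "skew C" for C u
    using that by (simp add: lie_blk wedge_minus_right matrix_vector_mult_diff_rdistrib)
  have half: "skew ((1/2) *\<^sub>R wedge (axis i 1) (axis j 1))" for i j by (simp add: skew_scaleR)
  have "(\<Sum>i\<in>UNIV. lie (blk 0 v) (lie (blk 0 w) (blk 0 (axis i 1))) $ Some i $ None) = 6 * (v \<bullet> w)"
    by (simp add: ll inner_axis' sum_subtractf inner_commute[of w v])
       (simp add: inner_vec_def)
  moreover have "(\<Sum>i\<in>UNIV. \<Sum>j\<in>UNIV. lie (blk 0 v) (lie (blk 0 w)
      (blk ((1/2) *\<^sub>R wedge (axis i 1) (axis j 1)) 0)) $ Some i $ Some j) = 6 * (v \<bullet> w)"
  proof -
    have "(\<Sum>i\<in>UNIV. \<Sum>j\<in>UNIV. lie (blk 0 v) (lie (blk 0 w)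
      (blk ((1/2) *\<^sub>R wedge (axis i 1) (axis j 1)) 0)) $ Some i $ Some j) =
      (\<Sum>i\<in>UNIV. \<Sum>j\<in>UNIV. (1/2) * (v $ i * w $ i + v $ j * w $ j
         - axis i 1 $ j * (v $ i * w $ j) - axis i 1 $ j * (v $ j * w $ i)))"
      by (intro sum.cong refl)
        (simp only: ll[OF half], simp add: flip: scaleR_matrix_vector_assoc,
         simp add: wedge_def inner_axis' inner_axis algebra_simps, simp add: axis_def)
    also have "\<dots> = 6 * (v \<bullet> w)"
      by (simp only: sum_distrib_left[symmetric] sum_subtractf sum.distrib)
        (simp add: inner_vec_def sum_distrib_left[symmetric] mult.left_commute[of _ 7])
    finally show ?thesis .
  qed
  ultimately show ?thesis
    by (simp add: killing_def trace_on_so17[OF linear_map_on_lie_lie *])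
qed

section \<open>The isotropy representation\<close>

lemma inner_amat: "amat v \<bullet> amat w = 6 * (v \<bullet> w)"
  by (simp add: inner_mat sum_shift_7[of _ 0] amat_nth inner_shift_7[of _ _ 0])

text \<open>The \<open>k\<close>-th equation of \<open>g2mat\<close> says that \<open>B\<close> is
  orthogonal to \<open>amat (axis k 1)\<close>: the pairing is -2 times its left-hand side.\<close>

lemma amat_inner_g2mat:
  assumes "g2mat B" shows "amat v \<bullet> B = 0"
proof -
  have sk: "B $ j $ i = - B $ i $ j" for i j
    using g2matD(1)[OF assms] unfolding skew_nth by blast
  have "amat v \<bullet> B = (\<Sum>i\<in>UNIV. v $ (i+1) * B $ i $ (i+3) - v $ (i+3) * B $ i $ (i+1)
      + v $ (i+2) * B $ i $ (i+6) - v $ (i+6) * B $ i $ (i+2)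
      + v $ (i+4) * B $ i $ (i+5) - v $ (i+5) * B $ i $ (i+4))"
    unfolding inner_mat
  proof (rule sum.cong[OF refl])
    fix i :: 7
    show "(\<Sum>j\<in>UNIV. amat v $ i $ j * B $ i $ j) = v $ (i+1) * B $ i $ (i+3) - v $ (i+3) * B $ i $ (i+1)
      + v $ (i+2) * B $ i $ (i+6) - v $ (i+6) * B $ i $ (i+2)
      + v $ (i+4) * B $ i $ (i+5) - v $ (i+5) * B $ i $ (i+4)"
      by (simp add: sum_shift_7[of _ i] amat_nth)
  qed
  also have "\<dots> = - 2 * (\<Sum>k\<in>UNIV. v $ k * (B $ (k+1) $ (k+3) + B $ (k+2) $ (k+6) + B $ (k+4) $ (k+5)))"
    by (simp add: sum_shift_7[of _ 0]
        sk[of 1 0] sk[of 2 0] sk[of 3 0] sk[of 4 0] sk[of 5 0] sk[of 6 0]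
        sk[of 2 1] sk[of 3 1] sk[of 4 1] sk[of 5 1] sk[of 6 1] sk[of 3 2] sk[of 4 2] sk[of 5 2] sk[of 6 2]
        sk[of 4 3] sk[of 5 3] sk[of 6 3] sk[of 5 4] sk[of 6 4] sk[of 6 5])
      (simp add: algebra_simps)
  also have "\<dots> = 0" using g2matD(2)[OF assms] by simp
  finally show ?thesis .
qed

lemma inner_wedge:
  assumes "skew B" shows "B \<bullet> wedge u v = 2 * (u \<bullet> (B *v v))"
proof -
  have "B \<bullet> wedge u v = u \<bullet> (B *v v) - v \<bullet> (B *v u)"
  proof -
    have "v \<bullet> (B *v u) = (\<Sum>i\<in>UNIV. \<Sum>j\<in>UNIV. v $ i * (B $ i $ j * u $ j))"
      by (simp add: inner_vec_def matrix_vector_mult_def sum_distrib_left)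
    moreover have "u \<bullet> (B *v v) = (\<Sum>i\<in>UNIV. \<Sum>j\<in>UNIV. u $ i * (B $ i $ j * v $ j))"
      by (simp add: inner_vec_def matrix_vector_mult_def sum_distrib_left)
    ultimately show ?thesis
      by (simp add: inner_mat wedge_def sum_subtractf[symmetric] algebra_simps)
  qed
  then show ?thesis using skew_inner[OF assms, of v u] by (simp add: inner_commute)
qed

text \<open>Testing orthogonality against the matrices \<open>dmat u w\<close> turns \<open>B\<close> into a multiple of
  left multiplication by the vector \<open>l\<close> representing \<open>v \<mapsto> B \<bullet> amat v\<close>.\<close>

lemma orthogonal_g2mat:
  assumes sk: "skew B" and orth: "\<And>C. g2mat C \<Longrightarrow> B \<bullet> C = 0"
  obtains v where "B = amat v"
proof
  define l where "l = (\<Sum>i\<in>UNIV. (B \<bullet> amat (axis i 1)) *\<^sub>R axis i 1 :: real^7)"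
  have l: "B \<bullet> amat v = l \<bullet> v" for v
  proof -
    have "amat v = (\<Sum>i\<in>UNIV. v $ i *\<^sub>R amat (axis i 1))"
      by (simp add: vec_eq_iff amat_nth algebra_simps sum.distrib sum_subtractf
          if_distrib[of "\<lambda>x. _ * x"] cong: if_cong)
    then show ?thesis
      by (simp add: l_def inner_sum_left inner_sum_right inner_axis' mult.commute)
  qed
  show "B = amat ((1/6) *\<^sub>R l)"
    unfolding matrix_eq
  proof
    fix w
    have "u \<bullet> (B *v w) = u \<bullet> (amat ((1/6) *\<^sub>R l) *v w)" for u
    proof -
      \<comment> \<open>This is orthogonality to \<open>dmat u w\<close>. As the triple product is
        alternating, it reads
        \<open>u \<bullet> (B *v w) = (1/6) * (u \<bullet> cross l w)\<close>.\<close>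
      have "2 * (u \<bullet> (B *v w)) + (1/3) * (l \<bullet> cross u w) = 0"
        using orth[OF g2mat_dmat[of u w]]
        by (simp add: dmat_def inner_add_right inner_wedge[OF sk] l)
      moreover have "l \<bullet> cross u w = - (u \<bullet> cross l w)"
        using inner_cross_skew[of w u l] inner_cross_skew[of w l u] cross_skew[of u w] cross_skew[of l w]
        by (simp add: inner_commute)
      ultimately show ?thesis by (simp add: cross_scaleR_left)
    qed
    then show "B *v w = amat ((1/6) *\<^sub>R l) *v w"
      by (metis vector_eq_ldot)
  qed
qed

lemma p1_iff: "A \<in> p1 \<longleftrightarrow> (\<exists>v. A = blk (amat v) 0)"
proof
  assume A: "A \<in> p1"
  then obtain B where B: "skew B" "A = blk B 0" unfolding p1_def so7_iff by blast
  have "B \<bullet> C = 0" if "g2mat C" for C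
  proof -
    have "killing so7 (blk B 0) (blk C 0) = 0"
      using A B(2) g2_iff that unfolding p1_def by blast
    then show ?thesis using killing_so7_blk[OF B(1) g2matD(1)[OF that]] by simp
  qed
  then show "\<exists>v. A = blk (amat v) 0" using orthogonal_g2mat[OF B(1)] B(2) by metis
next
  assume "\<exists>v. A = blk (amat v) 0"
  then obtain v where v: "A = blk (amat v) 0" by blast
  have "killing so7 A Y = 0" if "Y \<in> g2" for Y
  proof -
    obtain C where C: "g2mat C" "Y = blk C 0" using \<open>Y \<in> g2\<close> unfolding g2_iff by blast
    then show ?thesis
      using killing_so7_blk[OF skew_amat g2matD(1)[OF C(1)], of v] amat_inner_g2mat[OF C(1)] v by simp
  qed
  then show "A \<in> p1" using v so7_iff[of A] skew_amat unfolding p1_def by blast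
qed

section \<open>Coordinates on the tangent space, and the brackets in these coordinates\<close>

definition pv :: "real^7 \<Rightarrow> real^7 \<Rightarrow> mat8" where
  "pv v w = blk (amat v) w"

lemma pv_eq_iff [simp]: "pv v w = pv v' w' \<longleftrightarrow> v = v' \<and> w = w'"
  by (simp add: pv_def)

lemma pv_add: "pv v w + pv v' w' = pv (v + v') (w + w')"
  and pv_diff: "pv v w - pv v' w' = pv (v - v') (w - w')"
  and pv_scaleR: "c *\<^sub>R pv v w = pv (c *\<^sub>R v) (c *\<^sub>R w)"
  and pv_zero [simp]: "pv 0 0 = 0"
  by (simp_all add: pv_def blk_add blk_diff blk_scaleR blk_zero amat_add amat_diff amat_scaleR)

lemma pp_iff: "A \<in> pp \<longleftrightarrow> (\<exists>v w. A = pv v w)"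
proof -
  have "pv v w = blk (amat v) 0 + blk 0 w" for v w by (simp add: pv_def blk_add)
  then show ?thesis unfolding pp_def by (auto simp: p1_iff p2_iff)
qed

lemma pv_in_pp [simp]: "pv v w \<in> pp"
  using pp_iff by blast

lemma pv_p1: "pv v 0 \<in> p1" and pv_p2: "pv 0 w \<in> p2"
  unfolding p1_iff p2_iff pv_def by auto

lemma component_p2: "component p2 p1 (pv v w) = pv 0 w"
  unfolding component_def
proof (rule the_equality)
  show "pv 0 w \<in> p2 \<and> pv v w - pv 0 w \<in> p1" by (simp add: pv_p1 pv_p2 pv_diff)
next
  fix Y assume "Y \<in> p2 \<and> pv v w - Y \<in> p1"
  then show "Y = pv 0 w" by (auto simp: p1_iff p2_iff pv_def blk_diff)
qed

lemma component_p1: "component p1 p2 (pv v w) = pv v 0"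
  unfolding component_def
proof (rule the_equality)
  show "pv v 0 \<in> p1 \<and> pv v w - pv v 0 \<in> p2" by (simp add: pv_p1 pv_p2 pv_diff)
next
  fix Y assume "Y \<in> p1 \<and> pv v w - Y \<in> p2"
  then show "Y = pv v 0" by (auto simp: p1_iff p2_iff pv_def blk_diff)
qed

text \<open>One factor 6 of 36 comes from the Killing form on so(7), the other from
  \<open>inner_amat\<close>. The two copies of R^7 thus carry different scales, with ratio
  3.\<close>

lemma ip_pv: "ip (pv v w) (pv v' w') = 36 * (v \<bullet> v') + 12 * (w \<bullet> w')"
  using killing_so17_blk_skew[OF skew_amat skew_amat, of v v'] killing_so17_blk_vec[of w w']
  by (simp add: ip_def component_p1 component_p2 inner_amat) (simp add: pv_def inner_amat)

lemma g2mat_amat: "g2mat (amat v) \<Longrightarrow> v = 0"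
  using amat_inner_g2mat[of "amat v" v] by (simp add: inner_amat)

text \<open>Uniqueness of the components rests on \<open>g2mat_amat\<close>: a left multiplication
  lying in g2 is orthogonal to itself.\<close>

lemma component_pp_g2:
  assumes "g2mat D"
  shows "component pp g2 (blk (amat v + D) w) = pv v w"
    and "component g2 pp (blk (amat v + D) w) = blk D 0"
proof -
  show "component pp g2 (blk (amat v + D) w) = pv v w"
    unfolding component_def
  proof (rule the_equality)
    show "pv v w \<in> pp \<and> blk (amat v + D) w - pv v w \<in> g2"
      using assms by (auto simp: g2_iff pv_def[of v w] blk_diff intro: pv_in_pp[unfolded pv_def])
  next
    fix Y assume Y: "Y \<in> pp \<and> blk (amat v + D) w - Y \<in> g2"
    then obtain v' w' where Y': "Y = pv v' w'" using pp_iff by blast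
    obtain C where C: "g2mat C" "blk (amat v + D) w - Y = blk C 0"
      using Y g2_iff by blast
    have e: "C = amat (v - v') + D" "w = w'" using C(2) by (auto simp: Y' pv_def blk_diff amat_diff)
    have "g2mat (amat (v - v'))" using g2mat_diff[OF C(1) assms] e(1) by simp
    then show "Y = pv v w" using g2mat_amat e(2) Y' by fastforce
  qed
  show "component g2 pp (blk (amat v + D) w) = blk D 0"
    unfolding component_def
  proof (rule the_equality)
    show "blk D 0 \<in> g2 \<and> blk (amat v + D) w - blk D 0 \<in> pp"
      using assms by (auto simp: g2_iff blk_diff intro: pv_in_pp[unfolded pv_def])
  next
    fix Y assume Y: "Y \<in> g2 \<and> blk (amat v + D) w - Y \<in> pp"
    then obtain C where C: "g2mat C" "Y = blk C 0" using g2_iff by blast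
    obtain v' w' where Y': "blk (amat v + D) w - Y = pv v' w'" using Y pp_iff by blast
    have e: "amat (v' - v) = D - C" using Y' C(2) by (auto simp: pv_def blk_diff amat_diff algebra_simps)
    have "g2mat (amat (v' - v))" using g2mat_diff[OF assms C(1)] e by simp
    then have "D - C = 0" using e g2mat_amat[of "v' - v"] by simp
    then show "Y = blk D 0" using C(2) by simp
  qed
qed

text \<open>Arranged as left multiplication plus g2 part, so that both components can be read off;
  the \<open>wedge\<close> produced by two boosts is split by \<open>wedge_eq_dmat\<close>.\<close>

lemma lie_pv: "lie (pv v w) (pv v' w') =
  blk (amat (- cross v v' - (1/3) *\<^sub>R cross w w') + (dmat w w' - 3 *\<^sub>R dmat v v')) (cross v w' + cross w v')"
  unfolding pv_def lie_blk[OF skew_amat skew_amat] amat_commutator wedge_eq_dmat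
  by (simp add: amat_diff amat_minus amat_scaleR cross_skew[of w v'])

lemma component_lie_pv:
  "component pp g2 (lie (pv v w) (pv v' w')) =
     pv (- cross v v' - (1/3) *\<^sub>R cross w w') (cross v w' + cross w v')"
  "component g2 pp (lie (pv v w) (pv v' w')) = blk (dmat w w' - 3 *\<^sub>R dmat v v') 0"
  unfolding lie_pv by (simp_all add: component_pp_g2 g2mat_diff g2mat_scaleR)

text \<open>For a derivation \<open>B\<close>, the commutator with left multiplication by
  \<open>v\<close> is left multiplication by \<open>B *v v\<close>. Hence both summands carry the
  same representation of g2, which makes mixed terms in invariant forms possible.\<close>

lemma lie_g2_pv:
  assumes "g2mat B"
  shows "lie (blk B 0) (pv v w) = pv (B *v v) (B *v w)"
proof -
  have "B ** amat v - amat v ** B = amat (B *v v)"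
    unfolding matrix_eq using g2mat_derivation[OF assms]
    by (simp add: matrix_vector_mult_diff_rdistrib flip: matrix_vector_mul_assoc)
  then show ?thesis
    using g2matD(1)[OF assms] by (simp add: pv_def lie_blk)
qed

lemma subspace_pp: "subspace pp"
proof (rule subspaceI)
  show "0 \<in> pp" using pv_in_pp[of 0 0] by simp
qed (auto simp: pp_iff pv_add pv_scaleR)

text \<open>The entry of \<open>amat v\<close> at \<open>(i, i+3)\<close> is
  \<open>v $ (i+1)\<close>; here \<open>i = k+6\<close>.\<close>

definition vpart :: "mat8 \<Rightarrow> real^7" where
  "vpart X = (\<chi> k. X $ Some (k+6) $ Some (k+2))"

definition wpart :: "mat8 \<Rightarrow> real^7" where
  "wpart X = (\<chi> k. X $ Some k $ None)"

lemma vpart_pv [simp]: "vpart (pv v w) = v" and wpart_pv [simp]: "wpart (pv v w) = w"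
  by (simp_all add: vpart_def wpart_def pv_def amat_nth vec_eq_iff add.assoc)

lemma trace_on_pp:
  assumes f: "linear_map_on pp f" "f ` pp \<subseteq> pp"
  shows "trace_on pp f = (\<Sum>i\<in>UNIV. vpart (f (pv (axis i 1) 0)) $ i)
    + (\<Sum>i\<in>UNIV. wpart (f (pv 0 (axis i 1))) $ i)"
proof -
  define b where "b p = (case p of Inl i \<Rightarrow> pv (axis i 1) 0 | Inr i \<Rightarrow> pv 0 (axis i 1))" for p :: "7 + 7"
  define \<phi> where "\<phi> p X = (case p of Inl i \<Rightarrow> vpart X $ i | Inr i \<Rightarrow> wpart X $ i)" for p :: "7 + 7" and X :: mat8
  have sum_Plus: "(\<Sum>p\<in>UNIV. g p) = (\<Sum>i\<in>UNIV. g (Inl i)) + (\<Sum>i\<in>UNIV. g (Inr i))"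
    for g :: "7 + 7 \<Rightarrow> 'z::comm_monoid_add"
    by (simp add: UNIV_Plus_UNIV[symmetric] sum.Plus del: UNIV_Plus_UNIV)
  have sum_pv: "(\<Sum>i\<in>UNIV. pv (v i) (w i)) = pv (\<Sum>i\<in>UNIV. v i) (\<Sum>i\<in>UNIV. w i)" for v w :: "7 \<Rightarrow> _"
    by (simp add: sum_shift_7[of _ 0] pv_add)
  have "trace_on pp f = (\<Sum>p\<in>UNIV. \<phi> p (f (b p)))"
  proof (rule trace_on_frame[OF subspace_pp f])
    fix p show "b p \<in> pp" by (simp add: b_def split: sum.split)
    show "linear_map_on pp (\<phi> p)"
      by (auto simp: \<phi>_def linear_map_on_def vpart_def wpart_def split: sum.split)
  next
    fix X assume "X \<in> pp"
    then obtain v w where X: "X = pv v w" unfolding pp_iff by blast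
    show "X = (\<Sum>p\<in>UNIV. \<phi> p X *\<^sub>R b p)"
      unfolding sum_Plus b_def \<phi>_def
      by (simp add: X pv_scaleR sum_pv pv_add
        basis_expansion[of v, simplified scalar_mult_eq_scaleR]
        basis_expansion[of w, simplified scalar_mult_eq_scaleR])
  qed
  then show ?thesis by (simp add: sum_Plus b_def \<phi>_def)
qed

text \<open>Schur's lemma for the irreducible \<open>7\<close>-dimensional representation, by testing against
  differences of two of the three planes of rotation around a coordinate axis.\<close>

lemma invariant_bilinear:
  fixes \<beta> :: "real^7 \<Rightarrow> real^7 \<Rightarrow> real"
  assumes bil: "bilinear \<beta>"
    and inv: "\<And>B v w. g2mat B \<Longrightarrow> \<beta> (B *v v) w + \<beta> v (B *v w) = 0"
  shows "\<beta> v w = \<beta> (axis 0 1) (axis 0 1) * (v \<bullet> w)"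
proof -
  define e :: "7 \<Rightarrow> real^7" where "e i = axis i 1" for i
  define b where "b i j = \<beta> (e i) (e j)" for i j
  have ee: "e i \<bullet> e j = (if i = j then 1 else 0)" for i j
    by (simp add: e_def inner_axis_axis)
  have sym: "\<beta> v (- w) = - \<beta> v w" "\<beta> (- v) w = - \<beta> v w" "\<beta> 0 w = 0" "\<beta> v 0 = 0" for v w
    using bilinear_lneg[OF bil] bilinear_rneg[OF bil] bilinear_lzero[OF bil] bilinear_rzero[OF bil]
    by auto
  have g: "g2mat (wedge (e (k+1)) (e (k+3)) - wedge (e (k+2)) (e (k+6)))"
    "g2mat (wedge (e (k+2)) (e (k+6)) - wedge (e (k+4)) (e (k+5)))" for k
    unfolding g2mat_def all_shift_7[of _ k]
    by (intro conjI skew_diff skew_wedge; simp add: wedge_def e_def axis_def add.assoc)+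
  \<comment> \<open>The matrix in \<open>g(1)\<close> kills \<open>e k\<close>, so pairing
    \<open>e k\<close> with a vector of one of its planes yields an off-diagonal zero; the two
    vectors of one plane yield equality of two diagonal entries.\<close>
  have step: "b k (k+1) = 0" "b k (k+3) = 0" "b k (k+2) = 0" "b k (k+6) = 0"
    "b (k+1) (k+1) = b (k+3) (k+3)" for k
    using inv[OF g(1), of k "e k" "e (k+3)"] inv[OF g(1), of k "e k" "e (k+1)"]
      inv[OF g(1), of k "e k" "e (k+6)"] inv[OF g(1), of k "e k" "e (k+2)"]
      inv[OF g(1), of k "e (k+1)" "e (k+3)"]
    by (simp_all add: matrix_vector_mult_diff_rdistrib ee sym b_def)
  have step2: "b k (k+4) = 0" "b k (k+5) = 0" for k
    using inv[OF g(2), of k "e k" "e (k+5)"] inv[OF g(2), of k "e k" "e (k+4)"]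
    by (simp_all add: matrix_vector_mult_diff_rdistrib ee sym b_def)
  have off: "b i j = 0" if "i \<noteq> j" for i j
    by (rule shift_7_cases[of j i]) (use that step[of i] step2[of i] in auto)
  \<comment> \<open>Shifting by 6 turns the equality of the entries at \<open>k+1\<close> and
    \<open>k+3\<close> into a step by 2, and 2 generates the integers modulo 7.\<close>
  have st: "b (k+2) (k+2) = b k k" for k
    using step(5)[of "k+6"] by (simp add: add.assoc)
  have steps: "b 2 2 = b 0 0" "b 4 4 = b 2 2" "b 6 6 = b 4 4" "b 1 1 = b 6 6" "b 3 3 = b 1 1" "b 5 5 = b 3 3"
    using st[of 0] st[of 2] st[of 4] st[of 6] st[of 1] st[of 3] by simp_all
  have diag: "b i i = b 0 0" for i
    by (rule shift_7_cases[of i 0]) (simp_all add: steps)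
  have exp: "v = (\<Sum>i\<in>UNIV. v $ i *\<^sub>R e i)" for v :: "real^7"
    using basis_expansion[of v] by (simp add: scalar_mult_eq_scaleR e_def)
  have "\<beta> v w = \<beta> (\<Sum>i\<in>UNIV. v $ i *\<^sub>R e i) (\<Sum>i\<in>UNIV. w $ i *\<^sub>R e i)"
    using exp[of v] exp[of w] by simp
  also have "\<dots> = (\<Sum>(i,j)\<in>UNIV\<times>UNIV. v $ i * (w $ j * b i j))"
    unfolding bilinear_sum[OF bil]
    by (simp add: bilinear_lmul[OF bil] bilinear_rmul[OF bil] b_def mult_ac)
  also have "\<dots> = (\<Sum>i\<in>UNIV. \<Sum>j\<in>UNIV. v $ i * (w $ j * b i j))"
    by (simp add: sum.cartesian_product)
  also have "\<dots> = (\<Sum>i\<in>UNIV. \<Sum>j\<in>UNIV. if i = j then v $ i * (w $ i * b 0 0) else 0)"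
    using off diag by (intro sum.cong refl) auto
  also have "\<dots> = b 0 0 * (v \<bullet> w)"
    by (simp add: inner_vec_def sum_distrib_left mult_ac)
  finally show ?thesis by (simp add: b_def e_def)
qed

section \<open>Invariant forms and metrics as triples of numbers\<close>

definition form3 :: "real \<Rightarrow> real \<Rightarrow> real \<Rightarrow> (mat8 \<Rightarrow> mat8 \<Rightarrow> real) \<Rightarrow> bool" where
  "form3 a b c T \<longleftrightarrow> (\<forall>v w v' w'. T (pv v w) (pv v' w') =
     a * (v \<bullet> v') + b * (w \<bullet> w') + c * (v \<bullet> w' + w \<bullet> v'))"

lemma form3D: "form3 a b c T \<Longrightarrow> T (pv v w) (pv v' w') =
     a * (v \<bullet> v') + b * (w \<bullet> w') + c * (v \<bullet> w' + w \<bullet> v')"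
  by (simp add: form3_def)

text \<open>Schur's lemma applies to each block separately; symmetry ties the second mixed block to
  the first.\<close>

lemma invariant_sym_form_form3:
  assumes T: "invariant_sym_form g2 pp T"
  obtains a b c where "form3 a b c T"
proof -
  have lin: "T (X + X') Y = T X Y + T X' Y" "T (r *\<^sub>R X) Y = r * T X Y"
    and sym: "T X Y = T Y X" if "X \<in> pp" "X' \<in> pp" "Y \<in> pp" for X X' Y r
    using T that unfolding invariant_sym_form_def linear_map_on_def by auto
  have rlin: "T Y (X + X') = T Y X + T Y X'" "T Y (r *\<^sub>R X) = r * T Y X"
    if "X \<in> pp" "X' \<in> pp" "Y \<in> pp" for X X' Y r
    using lin sym that subspace_pp by (metis subspace_add, metis subspace_scale)
  have inv: "T (pv (B *v v) (B *v w)) (pv v' w') + T (pv v w) (pv (B *v v') (B *v w')) = 0"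
    if "g2mat B" for B v w v' w'
  proof -
    have "blk B 0 \<in> g2" using that g2_iff by blast
    then have "T (lie (blk B 0) (pv v w)) (pv v' w') + T (pv v w) (lie (blk B 0) (pv v' w')) = 0"
      using T pv_in_pp unfolding invariant_sym_form_def by blast
    then show ?thesis by (simp add: lie_g2_pv[OF that])
  qed
  have key: "\<exists>k. \<forall>v w. T (f v) (g w) = k * (v \<bullet> w)"
    if "f = (\<lambda>v. pv v 0) \<or> f = (\<lambda>v. pv 0 v)" "g = (\<lambda>v. pv v 0) \<or> g = (\<lambda>v. pv 0 v)" for f g
  proof -
    have f: "f v \<in> pp" "f (v + w) = f v + f w" "f (r *\<^sub>R v) = r *\<^sub>R f v" for v w r
      using that(1) by (auto simp: pv_add pv_scaleR)
    have g: "g v \<in> pp" "g (v + w) = g v + g w" "g (r *\<^sub>R v) = r *\<^sub>R g v" for v w r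
      using that(2) by (auto simp: pv_add pv_scaleR)
    have "bilinear (\<lambda>v w. T (f v) (g w))"
      unfolding bilinear_def by (auto intro!: linearI simp: f g lin[OF f(1) f(1) g(1)] rlin[OF g(1) g(1) f(1)])
    moreover have "T (f (B *v v)) (g w) + T (f v) (g (B *v w)) = 0" if "g2mat B" for B v w
      using inv[OF that, of v 0 w 0] inv[OF that, of v 0 0 w] inv[OF that, of 0 v w 0] inv[OF that, of 0 v 0 w]
        \<open>f = _ \<or> f = _\<close> \<open>g = _ \<or> g = _\<close> by auto
    ultimately have "T (f v) (g w) = T (f (axis 0 1)) (g (axis 0 1)) * (v \<bullet> w)" for v w
      by (rule invariant_bilinear)
    then show ?thesis by blast
  qed
  obtain a where a: "\<And>v w. T (pv v 0) (pv w 0) = a * (v \<bullet> w)"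
    using key[of "\<lambda>v. pv v 0" "\<lambda>v. pv v 0"] by auto
  obtain b where b: "\<And>v w. T (pv 0 v) (pv 0 w) = b * (v \<bullet> w)"
    using key[of "\<lambda>v. pv 0 v" "\<lambda>v. pv 0 v"] by auto
  obtain c where c: "\<And>v w. T (pv v 0) (pv 0 w) = c * (v \<bullet> w)"
    using key[of "\<lambda>v. pv v 0" "\<lambda>v. pv 0 v"] by auto
  have c': "T (pv 0 v) (pv w 0) = c * (v \<bullet> w)" for v w
    using c[of w v] sym[of "pv 0 v" "pv 0 v" "pv w 0"] by (simp add: inner_commute)
  have split: "pv v w = pv v 0 + pv 0 w" for v w by (simp add: pv_add)
  have "T (pv v w) (pv v' w') = a * (v \<bullet> v') + b * (w \<bullet> w') + c * (v \<bullet> w' + w \<bullet> v')" for v w v' w'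
  proof -
    have "T (pv v w) (pv v' w') = T (pv v 0) (pv v' w') + T (pv 0 w) (pv v' w')"
      using lin(1)[of "pv v 0" "pv 0 w" "pv v' w'"] by (simp add: pv_add)
    also have "\<dots> = T (pv v 0) (pv v' 0) + T (pv v 0) (pv 0 w') + (T (pv 0 w) (pv v' 0) + T (pv 0 w) (pv 0 w'))"
      using rlin(1)[of "pv v' 0" "pv 0 w'" "pv v 0"] rlin(1)[of "pv v' 0" "pv 0 w'" "pv 0 w"]
      by (simp add: pv_add)
    finally show ?thesis by (simp add: a b c c' algebra_simps)
  qed
  then show ?thesis using that unfolding form3_def by blast
qed

lemma form3_pos:
  assumes g: "invariant_metric g2 pp g" and f: "form3 a b c g"
  shows "a > 0" "b > 0" "a * b - c\<^sup>2 > 0"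
proof -
  define e :: "real^7" where "e = axis 0 1"
  have e: "e \<bullet> e = 1" "e \<noteq> 0" by (simp_all add: e_def inner_axis_axis)
  have pos: "g (pv v w) (pv v w) > 0" if "v \<noteq> 0 \<or> w \<noteq> 0" for v w
  proof -
    have "pv v w \<noteq> 0" using that pv_eq_iff[of v w 0 0] by simp
    then show ?thesis using g pv_in_pp unfolding invariant_metric_def by blast
  qed
  show a: "a > 0" using pos[of e 0] e by (simp add: form3D[OF f])
  show "b > 0" using pos[of 0 e] e by (simp add: form3D[OF f])
  \<comment> \<open>This vector is the Gram-Schmidt correction of
    \<open>pv 0 (a *\<^sub>R e)\<close>: it is \<open>g\<close>-orthogonal to \<open>p1\<close>, and
    its squared length isolates the determinant.\<close>
  have "0 < g (pv (- c *\<^sub>R e) (a *\<^sub>R e)) (pv (- c *\<^sub>R e) (a *\<^sub>R e))"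
    using pos[of "- c *\<^sub>R e" "a *\<^sub>R e"] e a by simp
  also have "\<dots> = a * (a * b - c\<^sup>2)"
    by (simp add: form3D[OF f] e power2_eq_square algebra_simps)
  finally show "a * b - c\<^sup>2 > 0" using a by (simp add: zero_less_mult_iff)
qed

lemma form3_metric:
  assumes a: "a > 0" and d: "a * b - c\<^sup>2 > 0"
  obtains g where "invariant_metric g2 pp g" "form3 a b c g"
proof
  define g where "g X Y = a * (vpart X \<bullet> vpart Y) + b * (wpart X \<bullet> wpart Y)
     + c * (vpart X \<bullet> wpart Y + wpart X \<bullet> vpart Y)" for X Y
  show f: "form3 a b c g" by (simp add: form3_def g_def)
  have "invariant_sym_form g2 pp g"
    unfolding invariant_sym_form_def linear_map_on_def
  proof (intro conjI ballI allI)
    fix X Y assume "X \<in> pp" "Y \<in> pp"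
    then show "g X Y = g Y X" by (simp add: g_def inner_commute algebra_simps)
  next
    fix Z X Y assume "Z \<in> g2" "X \<in> pp" "Y \<in> pp"
    then obtain B v w v' w' where *: "g2mat B" "Z = blk B 0" "X = pv v w" "Y = pv v' w'"
      unfolding g2_iff pp_iff by blast
    show "g (lie Z X) Y + g X (lie Z Y) = 0"
      unfolding * lie_g2_pv[OF *(1)] form3D[OF f]
      by (simp add: skew_inner[OF g2matD(1)[OF *(1)]] algebra_simps)
  qed (auto simp: pp_iff pv_add pv_scaleR form3D[OF f] inner_left_distrib algebra_simps)
  moreover have "g X X > 0" if "X \<in> pp" "X \<noteq> 0" for X
  proof -
    obtain v w where X: "X = pv v w" using \<open>X \<in> pp\<close> unfolding pp_iff by blast
    have "a * g X X = (a *\<^sub>R v + c *\<^sub>R w) \<bullet> (a *\<^sub>R v + c *\<^sub>R w) + (a * b - c\<^sup>2) * (w \<bullet> w)"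
      by (simp add: X form3D[OF f] inner_add_left inner_add_right inner_commute power2_eq_square algebra_simps)
    moreover have "\<dots> > 0"
    proof (cases "w = 0")
      case True
      then have "v \<noteq> 0" using that X by auto
      then show ?thesis using True a by simp
    next
      case False
      then show ?thesis using d by (simp add: add_nonneg_pos)
    qed
    ultimately show ?thesis using a by (metis zero_less_mult_pos)
  qed
  ultimately show "invariant_metric g2 pp g" unfolding invariant_metric_def by blast
qed

text \<open>By Schur's lemma \<open>L\<close> is multiplication by a number \<open>k\<close> in the
  coordinates of \<open>pv\<close>, and isometry gives \<open>36 = 12 * k^2\<close>. Only the square
  is fixed, since \<open>L\<close> is determined up to sign.\<close>

lemma adapted_basis_form:
  assumes L: "equivariant_isometry L" and x: "adapted_basis L x" and T: "form3 A B C T"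
  obtains k :: real where "k\<^sup>2 = 3" "T (x 1) (x 1) = A / 36" "T (x 8) (x 8) = B / 12" "T (x 1) (x 8) = k * C / 36"
proof -
  define M where "M v = wpart (L (pv v 0))" for v
  have LM: "L (pv v 0) = pv 0 (M v)" for v
  proof -
    have "L (pv v 0) \<in> p2" using L pv_p1 unfolding equivariant_isometry_def by blast
    then obtain w where "L (pv v 0) = blk 0 w" unfolding p2_iff by blast
    then have "L (pv v 0) = pv 0 w" by (simp add: pv_def)
    then show ?thesis by (simp add: M_def)
  qed
  have Llin: "L (X + Y) = L X + L Y" "L (r *\<^sub>R X) = r *\<^sub>R L X" if "X \<in> p1" "Y \<in> p1" for X Y r
    using L that unfolding equivariant_isometry_def linear_map_on_def by blast+
  have Madd: "M (v + w) = M v + M w" for v w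
    using Llin(1)[OF pv_p1 pv_p1, of v w] by (simp add: pv_add LM)
  have Mscale: "M (r *\<^sub>R v) = r *\<^sub>R M v" for v r
    using Llin(2)[OF pv_p1 pv_p1, of r v] by (simp add: pv_scaleR LM)
  have Mg: "M (B *v v) = B *v M v" if "g2mat B" for B v
  proof -
    have "blk B 0 \<in> g2" using that unfolding g2_iff by blast
    then have "L (lie (blk B 0) (pv v 0)) = lie (blk B 0) (L (pv v 0))"
      using L pv_p1 unfolding equivariant_isometry_def by blast
    then show ?thesis by (simp add: lie_g2_pv[OF that] LM)
  qed
  define k where "k = M (axis 0 1) \<bullet> axis 0 1"
  have "M v \<bullet> w = k * (v \<bullet> w)" for v w
    unfolding k_def
  proof (rule invariant_bilinear)
    show "bilinear (\<lambda>v w. M v \<bullet> w)"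
      unfolding bilinear_def by (auto intro!: linearI simp: Madd Mscale inner_add_left inner_add_right)
    fix B v w assume "g2mat B"
    then show "M (B *v v) \<bullet> w + M v \<bullet> (B *v w) = 0"
      by (simp add: Mg skew_inner[OF g2matD(1)])
  qed
  then have M: "M v = k *\<^sub>R v" for v
    by (intro vector_eq_rdot[THEN iffD1]) simp
  have x1: "x 1 \<in> p1" "x 8 = L (x 1)" "ip (x 1) (x 1) = 1"
    using x unfolding adapted_basis_def by force+
  then obtain v where v: "x 1 = pv v 0" unfolding p1_iff pv_def by blast
  have v2: "v \<bullet> v = 1 / 36" using x1(3) unfolding v by (simp add: ip_pv)
  have "ip (L (pv v 0)) (L (pv v 0)) = ip (pv v 0) (pv v 0)"
    using L pv_p1 unfolding equivariant_isometry_def by blast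
  then have k: "k\<^sup>2 = 3" by (simp add: LM M ip_pv v2 power2_eq_square)
  have x8: "x 8 = pv 0 (k *\<^sub>R v)" unfolding x1(2) v by (simp add: LM M)
  show ?thesis
  proof (rule that[OF k])
    show "T (x 1) (x 1) = A / 36" unfolding v using v2 by (simp add: form3D[OF T])
    have "T (x 8) (x 8) = B * (k\<^sup>2 * (v \<bullet> v))"
      unfolding x8 by (simp add: form3D[OF T] power2_eq_square)
    then show "T (x 8) (x 8) = B / 12" unfolding v2 k by simp
    show "T (x 1) (x 8) = k * C / 36" unfolding v x8 using v2 by (simp add: form3D[OF T])
  qed
qed

section \<open>Levi-Civita connection and Ricci tensor\<close>

text \<open>The difference \<open>S\<close> of two such connections is symmetric, and
  \<open>g (S X Y) Z\<close> is skew in \<open>Y\<close> and \<open>Z\<close>. Alternating both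
  symmetries returns to the start with a minus sign; \<open>Z = S X Y\<close> and definiteness
  finish.\<close>

lemma levi_civita_unique:
  assumes g: "invariant_metric h m g" and m: "subspace m"
    and L: "levi_civita h m g \<Lambda>" and L': "levi_civita h m g \<Lambda>'"
    and XY: "X \<in> m" "Y \<in> m"
  shows "\<Lambda> X Y = \<Lambda>' X Y"
proof -
  have sym: "g X Y = g Y X" if "X \<in> m" "Y \<in> m" for X Y
    using g that unfolding invariant_metric_def invariant_sym_form_def by blast
  have add: "g (X + X') Y = g X Y + g X' Y" and scale: "g (r *\<^sub>R X) Y = r * g X Y"
    if "X \<in> m" "X' \<in> m" "Y \<in> m" for X X' Y r
    using g that unfolding invariant_metric_def invariant_sym_form_def linear_map_on_def by auto
  have diff: "g (X - X') Y = g X Y - g X' Y" if "X \<in> m" "X' \<in> m" "Y \<in> m" for X X' Y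
    using add[of X "(-1) *\<^sub>R X'" Y] scale[of X' X Y "-1"] that subspace_scale[OF m that(2), of "-1"]
    by simp
  have in_m: "\<Lambda> X Y \<in> m" "\<Lambda>' X Y \<in> m" if "X \<in> m" "Y \<in> m" for X Y
    using L L' that unfolding levi_civita_def by blast+
  define S where "S X Y = \<Lambda> X Y - \<Lambda>' X Y" for X Y
  have S: "S X Y \<in> m" if "X \<in> m" "Y \<in> m" for X Y
    using that in_m m by (simp add: S_def subspace_diff)
  have S_sym: "S X Y = S Y X" if "X \<in> m" "Y \<in> m" for X Y
  proof -
    have "\<Lambda> X Y - \<Lambda> Y X = \<Lambda>' X Y - \<Lambda>' Y X"
      using L L' that unfolding levi_civita_def by simp
    then show ?thesis by (simp add: S_def algebra_simps)
  qed
  have S_skew: "g (S X Y) Z = - g (S X Z) Y" if "X \<in> m" "Y \<in> m" "Z \<in> m" for X Y Z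
  proof -
    have "g (\<Lambda> X Y) Z + g Y (\<Lambda> X Z) = 0" "g (\<Lambda>' X Y) Z + g Y (\<Lambda>' X Z) = 0"
      using L L' that unfolding levi_civita_def by blast+
    then show ?thesis
      using that in_m sym[of Y] by (simp add: S_def diff)
  qed
  define Z where "Z = S X Y"
  have Z: "Z \<in> m" using S XY by (simp add: Z_def)
  have "g (S X Y) Z = - g (S Z X) Y" using S_skew[of X Y Z] S_sym[of X Z] XY Z by simp
  also have "\<dots> = g (S Y Z) X" using S_skew[of Z X Y] S_sym[of Z Y] XY Z by simp
  also have "\<dots> = - g (S X Y) Z" using S_skew[of Y Z X] S_sym[of Y X] XY Z by simp
  finally have "g Z Z = 0" by (simp add: Z_def)
  then have "Z = 0" using g Z unfolding invariant_metric_def by force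
  then show ?thesis by (simp add: Z_def S_def)
qed

text \<open>The coefficients come from the Koszul formula. Those that depend on the metric reduce to
  \<open>U\<close> and \<open>V\<close>, which solve the linear system assumed in \<open>levi_civita_lc\<close>.\<close>

definition lc :: "real \<Rightarrow> real \<Rightarrow> mat8 \<Rightarrow> mat8 \<Rightarrow> mat8" where
  "lc U V X Y = (let v = vpart X; w = wpart X; v' = vpart Y; w' = wpart Y in
     pv (- (1/2) *\<^sub>R cross v v' - V *\<^sub>R cross v w' + V *\<^sub>R cross w v' - (1/6) *\<^sub>R cross w w')
        ((1 + U) *\<^sub>R cross v w' - U *\<^sub>R cross w v'))"

lemma lc_pv: "lc U V (pv v w) (pv v' w') =
     pv (- (1/2) *\<^sub>R cross v v' - V *\<^sub>R cross v w' + V *\<^sub>R cross w v' - (1/6) *\<^sub>R cross w w')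
        ((1 + U) *\<^sub>R cross v w' - U *\<^sub>R cross w v')"
  by (simp add: lc_def)

lemma levi_civita_lc:
  assumes f: "form3 a b c g"
    and 1: "V * a - U * c = 3/2 * c" and 2: "V * c - U * b = - a / 6"
  shows "levi_civita g2 pp g (lc U V)"
  unfolding levi_civita_def
proof (intro conjI ballI)
  fix X Y Z assume "X \<in> pp" "Y \<in> pp" "Z \<in> pp"
  then obtain v w v' w' v'' w'' where *: "X = pv v w" "Y = pv v' w'" "Z = pv v'' w''"
    unfolding pp_iff by blast
  have cyc: "cross x y \<bullet> z = - (cross x z \<bullet> y)" for x y z
    using inner_cross_skew[of x y z] by (simp add: inner_commute)
  \<comment> \<open>The triple product is alternating, so terms pairing equal parts of
    \<open>Y\<close> and \<open>Z\<close> cancel. Each surviving coefficient vanishes by one of the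
    two linear equations.\<close>
  have "g (lc U V X Y) Z + g Y (lc U V X Z) =
      (cross v v' \<bullet> w'') * (- c / 2 - (- V * a + (1 + U) * c))
    - (cross v v'' \<bullet> w') * ((- V * a + (1 + U) * c) + c / 2)
    + (cross w v' \<bullet> w'') * (V * c - U * b + a / 6)
    + (cross w v'' \<bullet> w') * (V * c - U * b + a / 6)"
    unfolding * lc_pv form3D[OF f]
    using cyc[of v v'' v'] cyc[of v w' v''] cyc[of v w'' v'] cyc[of v w'' w']
      cyc[of w v'' v'] cyc[of w w' v''] cyc[of w w'' v'] cyc[of w w'' w']
    by (simp add: inner_commute[of v'] inner_commute[of w'] inner_add_left inner_diff_left algebra_simps)
  also have "\<dots> = 0"
  proof -
    have "- c / 2 - (- V * a + (1 + U) * c) = 0" "(- V * a + (1 + U) * c) + c / 2 = 0"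
      "V * c - U * b + a / 6 = 0"
      using 1 2 by (simp_all add: algebra_simps)
    then show ?thesis by simp
  qed
  finally show "g (lc U V X Y) Z + g Y (lc U V X Z) = 0" .
next
  fix X Y assume "X \<in> pp" "Y \<in> pp"
  then obtain v w v' w' where *: "X = pv v w" "Y = pv v' w'"
    unfolding pp_iff by blast
  \<comment> \<open>\<open>U\<close> and \<open>V\<close> cancel here, and the coefficients -1/2 and
    -1/6 double to those of the bracket.\<close>
  show "lc U V X Y - lc U V Y X = component pp g2 (lie X Y)"
    unfolding * lc_pv component_lie_pv pv_diff pv_eq_iff
    by (simp add: cross_skew[of v' v] cross_skew[of v' w] cross_skew[of w' v] cross_skew[of w' w])
      (simp add: vec_eq_iff algebra_simps)
  show "lc U V X Y \<in> pp" by (simp add: * lc_pv)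
next
  fix X assume "X \<in> pp"
  then show "linear_map_on pp (lc U V X)"
    by (auto simp: linear_map_on_def pp_iff lc_pv pv_add pv_scaleR cross_linear algebra_simps)
next
  fix Y assume "Y \<in> pp"
  then show "linear_map_on pp (\<lambda>X. lc U V X Y)"
    by (auto simp: linear_map_on_def pp_iff lc_pv pv_add pv_scaleR cross_linear algebra_simps)
qed

section \<open>Curvature and Ricci tensor\<close>

lemma g2mat_lincomb_dmat: "g2mat (dmat w w' - 3 *\<^sub>R dmat v v')"
  by (simp add: g2mat_diff g2mat_scaleR)

lemma dmat_mult: "dmat v w *v u = (w \<bullet> u) *\<^sub>R v - (v \<bullet> u) *\<^sub>R w + (1/3) *\<^sub>R cross (cross v w) u"
  by (simp add: dmat_def matrix_vector_mult_add_rdistrib flip: scaleR_matrix_vector_assoc)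

lemma matrix_vector_mult_uminus: "(- M) *v u = - (M *v (u :: real^'n))"
  using matrix_vector_mult_diff_rdistrib[of 0 M u] by simp

lemma dmat_zero [simp]: "dmat 0 w = 0" "dmat v 0 = 0"
  by (simp_all add: dmat_def)

text \<open>The three terms of \<open>dmat_mult\<close> contribute \<open>7 - 1 - 2\<close>.\<close>

lemma trace_dmat: "(\<Sum>i\<in>UNIV. (dmat (axis i 1) w *v u) $ i) = 4 * (w \<bullet> u)"
proof -
  have "(\<Sum>i\<in>UNIV. (axis i 1 \<bullet> u) * w $ i) = w \<bullet> u"
    by (simp add: inner_axis' inner_vec_def mult.commute)
  then show ?thesis
    by (simp add: dmat_mult sum.distrib sum_subtractf sum_divide_distrib[symmetric] trace_cross_cross_left)
qed

text \<open>A Levi-Civita connection is determined on \<open>pp\<close> only, so the intermediate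
  values have to stay in \<open>pp\<close>.\<close>

lemma curvature_cong:
  assumes "\<And>X Y. X \<in> pp \<Longrightarrow> Y \<in> pp \<Longrightarrow> \<Lambda> X Y = \<Lambda>' X Y"
    and "\<And>X Y. X \<in> pp \<Longrightarrow> Y \<in> pp \<Longrightarrow> \<Lambda>' X Y \<in> pp"
    and "X \<in> pp" "Y \<in> pp" "Z \<in> pp"
  shows "curvature g2 pp \<Lambda> X Y Z = curvature g2 pp \<Lambda>' X Y Z"
proof -
  have "component pp g2 (lie X Y) \<in> pp"
    using assms(3,4) unfolding pp_iff by (auto simp: component_lie_pv)
  then show ?thesis using assms by (simp add: curvature_def)
qed

lemma curvature_lc_pv:
  "curvature g2 pp (lc U V) (pv x x') (pv y y') (pv z z') =
     lc U V (pv x x') (lc U V (pv y y') (pv z z')) - lc U V (pv y y') (lc U V (pv x x') (pv z z'))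
   - lc U V (pv (- cross x y - (1/3) *\<^sub>R cross x' y') (cross x y' + cross x' y)) (pv z z')
   - pv ((dmat x' y' - 3 *\<^sub>R dmat x y) *v z) ((dmat x' y' - 3 *\<^sub>R dmat x y) *v z')"
  by (simp add: curvature_def component_lie_pv lie_g2_pv[OF g2mat_lincomb_dmat])

lemma ricci_form:
  assumes g: "invariant_metric g2 pp g" and f: "form3 a b c g"
    and UV: "V * a - U * c = 3/2 * c" "V * c - U * b = - a / 6"
  shows "form3 (27/2 + 6 * U\<^sup>2) (- 6 - 2 * U + 6 * V\<^sup>2) (V * (6 * U + 9)) (ricci g2 pp g)"
  unfolding form3_def
proof (intro allI)
  fix y y' z z'
  define \<Lambda> where "\<Lambda> = (SOME \<Lambda>. levi_civita g2 pp g \<Lambda>)"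
  have lc: "levi_civita g2 pp g (lc U V)" by (rule levi_civita_lc[OF f UV])
  \<comment> \<open>The connection chosen inside \<open>ricci\<close> is arbitrary; uniqueness
    identifies it on \<open>pp\<close> with \<open>lc U V\<close>.\<close>
  then have "levi_civita g2 pp g \<Lambda>" unfolding \<Lambda>_def by (rule someI[where P = "levi_civita g2 pp g"])
  then have \<Lambda>: "\<Lambda> X Y = lc U V X Y" if "X \<in> pp" "Y \<in> pp" for X Y
    using levi_civita_unique[OF g subspace_pp _ lc] that by blast
  have lc_pp: "lc U V X Y \<in> pp" if "X \<in> pp" "Y \<in> pp" for X Y
    using lc that unfolding levi_civita_def by blast
  define R where "R X = curvature g2 pp \<Lambda> X (pv y y') (pv z z')" for X
  have R: "R (pv x x') =
     lc U V (pv x x') (lc U V (pv y y') (pv z z')) - lc U V (pv y y') (lc U V (pv x x') (pv z z'))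
   - lc U V (pv (- cross x y - (1/3) *\<^sub>R cross x' y') (cross x y' + cross x' y)) (pv z z')
   - pv ((dmat x' y' - 3 *\<^sub>R dmat x y) *v z) ((dmat x' y' - 3 *\<^sub>R dmat x y) *v z')" for x x'
    unfolding R_def curvature_lc_pv[symmetric] by (rule curvature_cong) (simp_all add: \<Lambda> lc_pp)
  note tr = trace_cross_right trace_cross_cross trace_cross_cross_left trace_dmat
  have "linear_map_on pp R"
    unfolding linear_map_on_def
    by (auto simp: pp_iff pv_add pv_scaleR R)
      (simp_all add: lc_pv pv_diff pv_add pv_scaleR dmat_mult matrix_vector_mult_diff_rdistrib
        cross_linear inner_add_left algebra_simps flip: scaleR_matrix_vector_assoc)
  moreover have "R ` pp \<subseteq> pp"
    by (auto simp: pp_iff R lc_pv pv_diff)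
  ultimately have "trace_on pp R = (\<Sum>i\<in>UNIV. vpart (R (pv (axis i 1) 0)) $ i)
    + (\<Sum>i\<in>UNIV. wpart (R (pv 0 (axis i 1))) $ i)"
    by (rule trace_on_pp)
  \<comment> \<open>The partial traces over the two summands need not be symmetric: the mixed
    coefficients are \<open>V * (6 * U + 9)\<close> and \<open>9 * V\<close> here, 0 and
    \<open>6 * U * V\<close> below. Only their sum is symmetric.\<close>
  also have "(\<Sum>i\<in>UNIV. vpart (R (pv (axis i 1) 0)) $ i) = 27/2 * (y \<bullet> z) + V * (6 * U + 9) * (y \<bullet> z')
      + 9 * V * (y' \<bullet> z) + (6 * V\<^sup>2 + U) * (y' \<bullet> z')"
    unfolding R
    by (simp add: lc_pv pv_diff matrix_vector_mult_diff_rdistrib matrix_vector_mult_uminus cross_linear tr sum.distrib sum_subtractf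
        sum_negf flip: scaleR_matrix_vector_assoc sum_distrib_left sum_divide_distrib)
      (simp add: power2_eq_square field_simps)
  also have "(\<Sum>i\<in>UNIV. wpart (R (pv 0 (axis i 1))) $ i) = 6 * U\<^sup>2 * (y \<bullet> z) + 6 * U * V * (y' \<bullet> z)
      - (6 + 3 * U) * (y' \<bullet> z')"
    unfolding R
    by (simp add: lc_pv pv_diff matrix_vector_mult_diff_rdistrib matrix_vector_mult_uminus cross_linear tr sum.distrib sum_subtractf
        sum_negf flip: scaleR_matrix_vector_assoc sum_distrib_left sum_divide_distrib)
      (simp add: power2_eq_square field_simps)
  finally show "ricci g2 pp g (pv y y') (pv z z') = (27/2 + 6 * U\<^sup>2) * (y \<bullet> z)
     + (- 6 - 2 * U + 6 * V\<^sup>2) * (y' \<bullet> z') + V * (6 * U + 9) * (y \<bullet> z' + y' \<bullet> z)"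
    by (simp add: ricci_def R_def[abs_def] \<Lambda>_def algebra_simps)
qed

section \<open>The image of the Ricci map\<close>

text \<open>Obtained from \<open>t2 = - 1/2 - U / 6 + W^2 / 6\<close> by putting
  \<open>U = (y - 3) / 2\<close> and \<open>W = 12 * t3 / y\<close> and multiplying by
  \<open>y^2\<close>.\<close>

definition hpoly :: "real \<Rightarrow> real \<Rightarrow> real \<Rightarrow> real" where
  "hpoly t2 t3 y = y^3 / 12 + (t2 + 1/4) * y\<^sup>2 - 24 * t3\<^sup>2"

text \<open>Divided by \<open>y^2\<close>, the polynomial is \<open>y / 12 - 24 * t3^2 / y^2\<close>
  plus a constant, and both terms are smaller at \<open>z\<close> than at \<open>Y\<close>.
  Cross-multiplying covers \<open>z = 0\<close> as well.\<close>

lemma hpoly_neg: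
  assumes Y: "hpoly t2 t3 Y = 0" "t3 \<noteq> 0" and z: "\<bar>z\<bar> < Y"
  shows "hpoly t2 t3 z < 0"
proof -
  have Y0: "Y > 0" using z by simp
  have "Y\<^sup>2 * hpoly t2 t3 z = Y\<^sup>2 * hpoly t2 t3 z - z\<^sup>2 * hpoly t2 t3 Y" using Y by simp
  also have "\<dots> = - (z\<^sup>2 * Y\<^sup>2 * (Y - z) / 12) - 24 * t3\<^sup>2 * (Y\<^sup>2 - z\<^sup>2)"
    by (simp add: hpoly_def power2_eq_square power3_eq_cube field_simps)
  also have "\<dots> < 0"
  proof -
    have "z\<^sup>2 < Y\<^sup>2" using z by (metis abs_ge_zero power2_abs power_strict_mono zero_less_numeral)
    then have "24 * t3\<^sup>2 * (Y\<^sup>2 - z\<^sup>2) > 0" using Y(2) by simp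
    moreover have "z\<^sup>2 * Y\<^sup>2 * (Y - z) / 12 \<ge> 0" using z by simp
    ultimately show ?thesis by linarith
  qed
  finally show ?thesis using Y0 by (simp add: mult_less_0_iff)
qed

text \<open>The three roots of \<open>cubic\<close> are the values of \<open>y \<mapsto> 3/8 + (y - 3)\<^sup>2 / 24\<close> at the roots of \<open>hpoly\<close>.\<close>

lemma cubic_hpoly:
  "cubic t2 t3 (3/8 + s\<^sup>2 / 24) = - (4/3) * (hpoly t2 t3 (3 + s) * hpoly t2 t3 (3 - s))"
  unfolding cubic_def hpoly_def
  by (simp add: power2_eq_square power3_eq_cube power4_eq_xxxx field_simps)

text \<open>The norm of \<open>hpoly t2 t3 (3 + \<i> \<sigma>)\<close> for \<open>\<sigma>\<^sup>2 = q\<close>.\<close>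

lemma cubic_hpoly_imaginary:
  "cubic t2 t3 (3/8 - q / 24) = - (4/3) * ((9/4 - 3/4 * q + (t2 + 1/4) * (9 - q) - 24 * t3\<^sup>2)\<^sup>2
      + q * (9/4 - q / 12 + 6 * (t2 + 1/4))\<^sup>2)"
  unfolding cubic_def
  by (simp add: power2_eq_square power3_eq_cube power4_eq_xxxx field_simps)

lemma finite_cubic_roots: "finite {t. cubic t2 t3 t = 0}"
proof -
  define p where "p = [: - 432 * t2^2 - 432 * t2 - 768 * t3^4 - 288 * t3^2 - 135,
    1152 * t2^2 + 1536 * t2 * t3^2 + 1152 * t2 + 1536 * t3^2 + 432,
    - 768 * t2^2 - 768 * t2 - 432, 128 :]"
  have "cubic t2 t3 t = poly p t" for t
    by (simp add: cubic_def p_def power2_eq_square power3_eq_cube algebra_simps)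
  moreover have "p \<noteq> 0" by (simp add: p_def)
  ultimately show ?thesis using poly_roots_finite[of p] by simp
qed

lemma f1_eq:
  assumes Y: "hpoly t2 t3 Y = 0" "Y > 3" and t3: "t3 \<noteq> 0"
  shows "f1 t2 t3 = 3/8 + (Y - 3)\<^sup>2 / 24"
  unfolding f1_def
proof (rule Min_eqI[OF finite_cubic_roots])
  show "3/8 + (Y - 3)\<^sup>2 / 24 \<in> {t. cubic t2 t3 t = 0}"
    using cubic_hpoly[of t2 t3 "Y - 3"] Y by simp
next
  fix t assume "t \<in> {t. cubic t2 t3 t = 0}"
  then have t: "cubic t2 t3 t = 0" by simp
  show "3/8 + (Y - 3)\<^sup>2 / 24 \<le> t"
  proof (rule ccontr)
    assume "\<not> ?thesis"
    then have less: "t < 3/8 + (Y - 3)\<^sup>2 / 24" by simp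
    show False
    proof (cases "t \<ge> 3/8")
      case True
      \<comment> \<open>Here \<open>3 + s\<close> and \<open>3 - s\<close> both lie strictly between
        \<open>- Y\<close> and \<open>Y\<close>, so both factors in \<open>cubic_hpoly\<close> are
        negative and \<open>cubic\<close> cannot vanish.\<close>
      define s where "s = sqrt (24 * t - 9)"
      have s: "s \<ge> 0" "s\<^sup>2 = 24 * t - 9" using True by (simp_all add: s_def)
      then have ts: "t = 3/8 + s\<^sup>2 / 24" by (simp add: field_simps)
      have "s\<^sup>2 < (Y - 3)\<^sup>2" using less s(2) by simp
      then have "s < Y - 3" using Y(2) by (simp add: power_less_imp_less_base)
      then have "hpoly t2 t3 (3 + s) < 0" "hpoly t2 t3 (3 - s) < 0"
        using s(1) by (auto intro!: hpoly_neg[OF Y(1) t3])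
      then show False using t unfolding ts cubic_hpoly by (auto simp: mult_eq_0_iff)
    next
      case False
      \<comment> \<open>For \<open>t < 3/8\<close> the parameter \<open>s\<close> is imaginary with
        square \<open>- q\<close>. Both squares must vanish; the second determines
        \<open>t2\<close>, and the first then makes a positive number equal to a negative
        one.\<close>
      define q where "q = 9 - 24 * t"
      have q: "q > 0" "t = 3/8 - q / 24" using False by (simp_all add: q_def field_simps)
      have *: "(9/4 - 3/4 * q + (t2 + 1/4) * (9 - q) - 24 * t3\<^sup>2)\<^sup>2
          + q * (9/4 - q / 12 + 6 * (t2 + 1/4))\<^sup>2 = 0"
        using t unfolding q(2) cubic_hpoly_imaginary by simp
      have re: "9/4 - 3/4 * q + (t2 + 1/4) * (9 - q) - 24 * t3\<^sup>2 = 0"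
        and im: "9/4 - q / 12 + 6 * (t2 + 1/4) = 0"
        using * q(1) by (simp_all add: add_nonneg_eq_0_iff)
      have p: "t2 + 1/4 = (q - 27) / 72" using im by simp
      have "(q + 9)\<^sup>2 = - 1728 * t3\<^sup>2"
        using re unfolding p by (simp add: power2_eq_square field_simps)
      then show False using t3 zero_less_power2[of t3] zero_le_power2[of "q + 9"] by linarith
    qed
  qed
qed

text \<open>The right-hand side is negativity of \<open>hpoly\<close> at 3. A root beyond 3 forces
  it by \<open>hpoly_neg\<close>; conversely \<open>hpoly\<close> becomes nonnegative for large
  arguments.\<close>

lemma hpoly_root_iff:
  assumes t3: "t3 \<noteq> 0"
  shows "(\<exists>Y>3. hpoly t2 t3 Y = 0) \<longleftrightarrow> t3\<^sup>2 > 3/16 * (2 * t2 + 1)"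
proof -
  have h3: "hpoly t2 t3 3 = 9 * t2 + 9/2 - 24 * t3\<^sup>2" by (simp add: hpoly_def)
  show ?thesis
  proof
    assume "\<exists>Y>3. hpoly t2 t3 Y = 0"
    then obtain Y where "Y > 3" "hpoly t2 t3 Y = 0" by blast
    then have "hpoly t2 t3 3 < 0" using hpoly_neg[OF _ t3, of t2 Y 3] by simp
    then show "t3\<^sup>2 > 3/16 * (2 * t2 + 1)" using h3 by simp
  next
    assume "t3\<^sup>2 > 3/16 * (2 * t2 + 1)"
    then have neg: "hpoly t2 t3 3 < 0" using h3 by simp
    have "\<exists>b\<ge>3. hpoly t2 t3 b \<ge> 0"
    proof -
      \<comment> \<open>The factor 12 makes \<open>b / 12 + (t2 + 1/4)\<close> at least
        \<open>24 * t3^2\<close>; the summand 3 ensures \<open>b \<ge> 3\<close> and so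
        \<open>b^2 \<ge> 1\<close>.\<close>
      define b where "b = 12 * (\<bar>t2 + 1/4\<bar> + 24 * t3\<^sup>2) + 3"
      have b: "b \<ge> 3" by (simp add: b_def)
      have "hpoly t2 t3 b = (b / 12 + (t2 + 1/4)) * b\<^sup>2 - 24 * t3\<^sup>2"
        by (simp add: hpoly_def power2_eq_square power3_eq_cube field_simps)
      moreover have "24 * t3\<^sup>2 * 1 \<le> (b / 12 + (t2 + 1/4)) * b\<^sup>2"
      proof (rule mult_mono)
        show "24 * t3\<^sup>2 \<le> b / 12 + (t2 + 1/4)" using abs_ge_minus_self[of "t2 + 1/4"] zero_le_power2[of t3] unfolding b_def by argo
        then show "0 \<le> b / 12 + (t2 + 1/4)" using zero_le_power2[of t3] by linarith
        show "1 \<le> b\<^sup>2" using b by (simp add: one_le_power)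
      qed simp
      ultimately show ?thesis using b by auto
    qed
    then obtain b where b: "b \<ge> 3" "hpoly t2 t3 b \<ge> 0" by blast
    have "continuous_on {3..b} (hpoly t2 t3)"
      unfolding hpoly_def[abs_def] by (intro continuous_intros) simp
    then obtain Y where "3 \<le> Y" "hpoly t2 t3 Y = 0"
      using IVT'[of "hpoly t2 t3" 3 0 b] neg b by auto
    then show "\<exists>Y>3. hpoly t2 t3 Y = 0" using neg by (metis order_le_less order_less_irrefl)
  qed
qed

lemma ricci_image_iff:
  "(\<exists>U W. U > 0 \<and> t1 = 3/8 + U\<^sup>2 / 6 \<and> t2 = - 1/2 - U / 6 + W\<^sup>2 / 6 \<and> t3 = W * (2 * U + 3) / 12) \<longleftrightarrow>
    (t3 = 0 \<longrightarrow> t1 = 6 * t2^2 + 6 * t2 + 15/8 \<and> t2 < - 1/2) \<and>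
    (t3 \<noteq> 0 \<longrightarrow>
       (t2 \<le> - 3/4 \<and> \<bar>t3\<bar> > 0 \<and> t1 = f1 t2 t3) \<or>
       (- 3/4 < t2 \<and> t2 \<le> - 1/2 \<and> \<bar>t3\<bar> > 0 \<and>
          \<bar>t3\<bar> \<noteq> 1/2 * sqrt (3/2) * sqrt (4 * t2 + 3) \<and> t1 = f1 t2 t3) \<or>
       (t2 > - 1/2 \<and> \<bar>t3\<bar> > sqrt 3 / 4 * sqrt (2 * t2 + 1) \<and>
          \<bar>t3\<bar> \<noteq> 1/2 * sqrt (3/2) * sqrt (4 * t2 + 3) \<and> t1 = f1 t2 t3) \<or>
       (t2 > - 3/4 \<and> \<bar>t3\<bar> = 1/2 * sqrt (3/2) * sqrt (4 * t2 + 3) \<and> t1 = 3/4))"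
  (is "?L \<longleftrightarrow> ?R")
proof (cases "t3 = 0")
  case True
  have "?L \<longleftrightarrow> (\<exists>U>0. t1 = 3/8 + U\<^sup>2 / 6 \<and> t2 = - 1/2 - U / 6)"
  proof
    assume ?L
    then obtain U W where UW: "U > 0" "t1 = 3/8 + U\<^sup>2 / 6" "t2 = - 1/2 - U / 6 + W\<^sup>2 / 6" "t3 = W * (2 * U + 3) / 12"
      by blast
    then have "W = 0" using True by auto
    then show "\<exists>U>0. t1 = 3/8 + U\<^sup>2 / 6 \<and> t2 = - 1/2 - U / 6" using UW by auto
  next
    assume "\<exists>U>0. t1 = 3/8 + U\<^sup>2 / 6 \<and> t2 = - 1/2 - U / 6"
    then obtain U where "U > 0" "t1 = 3/8 + U\<^sup>2 / 6" "t2 = - 1/2 - U / 6" by blast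
    then have "U > 0 \<and> t1 = 3/8 + U\<^sup>2 / 6 \<and> t2 = - 1/2 - U / 6 + 0\<^sup>2 / 6 \<and> t3 = 0 * (2 * U + 3) / 12"
      using True by simp
    then show ?L by blast
  qed
  also have "\<dots> \<longleftrightarrow> t1 = 6 * t2^2 + 6 * t2 + 15/8 \<and> t2 < - 1/2"
  proof
    assume "t1 = 6 * t2^2 + 6 * t2 + 15/8 \<and> t2 < - 1/2"
    \<comment> \<open>The witness solves \<open>t2 = - 1/2 - U / 6\<close> for
      \<open>U\<close>.\<close>
    then show "\<exists>U>0. t1 = 3/8 + U\<^sup>2 / 6 \<and> t2 = - 1/2 - U / 6"
      by (intro exI[of _ "- 3 - 6 * t2"]) (simp add: power2_eq_square field_simps)
  next
    assume "\<exists>U>0. t1 = 3/8 + U\<^sup>2 / 6 \<and> t2 = - 1/2 - U / 6"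
    then obtain U where U: "U > 0" "t1 = 3/8 + U\<^sup>2 / 6" "t2 = - 1/2 - U / 6" by blast
    then show "t1 = 6 * t2^2 + 6 * t2 + 15/8 \<and> t2 < - 1/2"
      unfolding U(2,3) by (simp add: power2_eq_square field_simps)
  qed
  finally show ?thesis using True by simp
next
  case t3: False
  have L: "?L \<longleftrightarrow> (\<exists>Y>3. hpoly t2 t3 Y = 0 \<and> t1 = 3/8 + (Y - 3)\<^sup>2 / 24)"
  proof
    assume ?L
    then obtain U W where UW: "U > 0" "t1 = 3/8 + U\<^sup>2 / 6" "t2 = - 1/2 - U / 6 + W\<^sup>2 / 6" "t3 = W * (2 * U + 3) / 12"
      by blast
    have "hpoly t2 t3 (2 * U + 3) = 0"
      unfolding hpoly_def UW(3,4) by (simp add: power2_eq_square power3_eq_cube field_simps)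
    then show "\<exists>Y>3. hpoly t2 t3 Y = 0 \<and> t1 = 3/8 + (Y - 3)\<^sup>2 / 24"
      using UW(1,2) by (intro exI[of _ "2 * U + 3"]) (simp add: power2_eq_square)
  next
    assume "\<exists>Y>3. hpoly t2 t3 Y = 0 \<and> t1 = 3/8 + (Y - 3)\<^sup>2 / 24"
    then obtain Y where Y: "Y > 3" "hpoly t2 t3 Y = 0" "t1 = 3/8 + (Y - 3)\<^sup>2 / 24" by blast
    \<comment> \<open>Inverse substitution: \<open>U = (Y - 3) / 2\<close> and
      \<open>W = 12 * t3 / Y\<close>.\<close>
    have "(Y - 3) / 2 > 0" using Y(1) by simp
    moreover have "t1 = 3/8 + ((Y - 3) / 2)\<^sup>2 / 6" using Y(3) by (simp add: power_divide)
    moreover have "t2 = - 1/2 - (Y - 3) / 2 / 6 + (12 * t3 / Y)\<^sup>2 / 6"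
      using Y(1,2) by (simp add: hpoly_def power2_eq_square power3_eq_cube field_simps)
    moreover have "t3 = 12 * t3 / Y * (2 * ((Y - 3) / 2) + 3) / 12"
      using Y(1) by (simp add: field_simps)
    ultimately show ?L by blast
  qed
  have cond: "?L \<longleftrightarrow> t3\<^sup>2 > 3/16 * (2 * t2 + 1) \<and> t1 = f1 t2 t3"
    unfolding L hpoly_root_iff[OF t3, symmetric] using f1_eq[OF _ _ t3] by metis
  have "sqrt 3 / 4 = sqrt (3/16)" by (simp add: real_sqrt_divide)
  then have sqrt1: "sqrt 3 / 4 * sqrt (2 * t2 + 1) = sqrt (3/16 * (2 * t2 + 1))"
    by (simp only: real_sqrt_mult)
  \<comment> \<open>\<open>sqrt\<close> is odd, strictly increasing and multiplicative on all reals,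
    so the equivalence also holds for negative \<open>2 * t2 + 1\<close>.\<close>
  have gt: "\<bar>t3\<bar> > sqrt 3 / 4 * sqrt (2 * t2 + 1) \<longleftrightarrow> t3\<^sup>2 > 3/16 * (2 * t2 + 1)"
    unfolding sqrt1 real_sqrt_abs[symmetric] real_sqrt_less_iff ..
  have "1/2 * sqrt (3/2) = sqrt (3/8)"
    by (rule real_sqrt_unique[symmetric]) (simp_all add: power_divide)
  then have sqrt2: "1/2 * sqrt (3/2) * sqrt (4 * t2 + 3) = sqrt (3/8 * (4 * t2 + 3))"
    by (simp only: real_sqrt_mult)
  have eq: "\<bar>t3\<bar> = 1/2 * sqrt (3/2) * sqrt (4 * t2 + 3) \<longleftrightarrow> t3\<^sup>2 = 3/8 * (4 * t2 + 3)"
    unfolding sqrt2 real_sqrt_abs[symmetric] real_sqrt_eq_iff ..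
  \<comment> \<open>The condition says that 6 is a root of \<open>hpoly\<close>, and
    \<open>3/8 + 9/24 = 3/4\<close>. The fourth line thus records the value of \<open>f1\<close> on
    this curve.\<close>
  have exc: "f1 t2 t3 = 3/4" if "t3\<^sup>2 = 3/8 * (4 * t2 + 3)"
  proof -
    have "hpoly t2 t3 6 = 0" unfolding hpoly_def that by (simp add: algebra_simps)
    then show ?thesis using f1_eq[of t2 t3 6] t3 by simp
  qed
  have "t3\<^sup>2 > 0" using t3 by simp
  then have low: "t3\<^sup>2 > 3/16 * (2 * t2 + 1)" if "t2 \<le> - 1/2" using that by argo
  \<comment> \<open>On the exceptional curve \<open>t3^2 > 0\<close> forces
    \<open>t2 > - 3/4\<close>, and then the lower bound on \<open>t3^2\<close> holds. For
    \<open>t2 \<le> - 1/2\<close> that bound is nonpositive. So the four lines together say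
    \<open>t1 = f1 t2 t3\<close> above the bound.\<close>
  show ?thesis
    unfolding cond gt eq using t3 low exc
    by (cases "t3\<^sup>2 = 3/8 * (4 * t2 + 3)"; cases "t2 \<le> - 1/2") auto
qed

section \<open>From metrics to the pairs \<open>U\<close>, \<open>V\<close>, and from there to the
  normalized coefficients\<close>

theorem theorem30:
  fixes T :: "mat8 \<Rightarrow> mat8 \<Rightarrow> real"
    and L :: "mat8 \<Rightarrow> mat8"
    and x :: "nat \<Rightarrow> mat8"
    and t1 t2 t3 :: real
  assumes "equivariant_isometry L"
    and "adapted_basis L x"
    and "invariant_sym_form g2 pp T"
    and "t1 = T (x 1) (x 1)"
    and "t2 = T (x 8) (x 8)"
    and "t3 = T (x 1) (x 8)"
  shows "(\<exists>g. invariant_metric g2 pp g \<and> (\<forall>X\<in>pp. \<forall>Y\<in>pp. ricci g2 pp g X Y = T X Y)) \<longleftrightarrow>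
    (t3 = 0 \<longrightarrow> t1 = 6 * t2^2 + 6 * t2 + 15/8 \<and> t2 < - 1/2) \<and>
    (t3 \<noteq> 0 \<longrightarrow>
       (t2 \<le> - 3/4 \<and> \<bar>t3\<bar> > 0 \<and> t1 = f1 t2 t3) \<or>
       (- 3/4 < t2 \<and> t2 \<le> - 1/2 \<and> \<bar>t3\<bar> > 0 \<and>
          \<bar>t3\<bar> \<noteq> 1/2 * sqrt (3/2) * sqrt (4 * t2 + 3) \<and> t1 = f1 t2 t3) \<or>
       (t2 > - 1/2 \<and> \<bar>t3\<bar> > sqrt 3 / 4 * sqrt (2 * t2 + 1) \<and>
          \<bar>t3\<bar> \<noteq> 1/2 * sqrt (3/2) * sqrt (4 * t2 + 3) \<and> t1 = f1 t2 t3) \<or>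
       (t2 > - 3/4 \<and> \<bar>t3\<bar> = 1/2 * sqrt (3/2) * sqrt (4 * t2 + 3) \<and> t1 = 3/4))"
proof -
  obtain A B C where T: "form3 A B C T"
    using invariant_sym_form_form3[OF assms(3)] .
  obtain k where k: "k\<^sup>2 = 3" and t: "t1 = A / 36" "t2 = B / 12" "t3 = k * C / 36"
    using adapted_basis_form[OF assms(1,2) T] assms(4-6) by metis
  define e :: "real^7" where "e = axis 0 1"
  have e: "e \<bullet> e = 1" by (simp add: e_def inner_axis_axis)
  have form3_eqI: "(\<forall>X\<in>pp. \<forall>Y\<in>pp. S X Y = T X Y) \<longleftrightarrow> a = A \<and> b = B \<and> c = C"
    if S: "form3 a b c S" for S a b c
  proof
    assume "\<forall>X\<in>pp. \<forall>Y\<in>pp. S X Y = T X Y"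
    then have "S (pv e 0) (pv e 0) = T (pv e 0) (pv e 0)" "S (pv 0 e) (pv 0 e) = T (pv 0 e) (pv 0 e)"
      "S (pv e 0) (pv 0 e) = T (pv e 0) (pv 0 e)" by simp_all
    then show "a = A \<and> b = B \<and> c = C" by (simp add: form3D[OF S] form3D[OF T] e)
  qed (auto simp: pp_iff form3D[OF S] form3D[OF T])
  have "(\<exists>g. invariant_metric g2 pp g \<and> (\<forall>X\<in>pp. \<forall>Y\<in>pp. ricci g2 pp g X Y = T X Y)) \<longleftrightarrow>
    (\<exists>U V. U > 0 \<and> 27/2 + 6 * U\<^sup>2 = A \<and> - 6 - 2 * U + 6 * V\<^sup>2 = B \<and> V * (6 * U + 9) = C)"
  proof
    assume "\<exists>g. invariant_metric g2 pp g \<and> (\<forall>X\<in>pp. \<forall>Y\<in>pp. ricci g2 pp g X Y = T X Y)"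
    then obtain g where g: "invariant_metric g2 pp g" and ric: "\<forall>X\<in>pp. \<forall>Y\<in>pp. ricci g2 pp g X Y = T X Y"
      by blast
    have "invariant_sym_form g2 pp g" using g by (simp add: invariant_metric_def)
    then obtain a b c where f: "form3 a b c g" by (rule invariant_sym_form_form3)
    define D where "D = a * b - c\<^sup>2"
    have pos: "a > 0" "D > 0" using form3_pos[OF g f] by (simp_all add: D_def)
    \<comment> \<open>Cramer's rule for the system in \<open>levi_civita_lc\<close>, whose
      determinant is \<open>- D\<close>; this form shows \<open>U > 0\<close>.\<close>
    define U where "U = (a\<^sup>2 + 9 * c\<^sup>2) / (6 * D)"
    define V where "V = c * (a + 9 * b) / (6 * D)"
    have "V * a - U * c = 3/2 * c" "V * c - U * b = - a / 6"
      using pos(2) by (simp_all add: U_def V_def field_simps) (simp_all add: D_def power2_eq_square algebra_simps)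
    from ricci_form[OF g f this] form3_eqI ric
    have "27/2 + 6 * U\<^sup>2 = A \<and> - 6 - 2 * U + 6 * V\<^sup>2 = B \<and> V * (6 * U + 9) = C" by blast
    moreover have "U > 0" using pos by (simp add: U_def add_pos_nonneg)
    ultimately show "\<exists>U V. U > 0 \<and> 27/2 + 6 * U\<^sup>2 = A \<and> - 6 - 2 * U + 6 * V\<^sup>2 = B \<and> V * (6 * U + 9) = C"
      by blast
  next
    assume "\<exists>U V. U > 0 \<and> 27/2 + 6 * U\<^sup>2 = A \<and> - 6 - 2 * U + 6 * V\<^sup>2 = B \<and> V * (6 * U + 9) = C"
    then obtain U V where UV: "U > 0" "27/2 + 6 * U\<^sup>2 = A \<and> - 6 - 2 * U + 6 * V\<^sup>2 = B \<and> V * (6 * U + 9) = C"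
      by blast
    \<comment> \<open>Rescaling a metric does not change its connection, so \<open>a = 1\<close> may
      be fixed; the two linear equations then give \<open>c\<close> and \<open>b\<close> in
      turn.\<close>
    define c where "c = V / (U + 3/2)"
    define b where "b = (V * c + 1/6) / U"
    have V: "V = c * (U + 3/2)" using UV(1) by (simp add: c_def)
    have "1 * b - c\<^sup>2 = (3/2 * c\<^sup>2 + 1/6) / U"
      using UV(1) by (simp add: b_def V power2_eq_square field_simps)
    also have "\<dots> > 0" using UV(1) by (simp add: add_nonneg_pos)
    finally obtain g where g: "invariant_metric g2 pp g" and f: "form3 1 b c g"
      using form3_metric[of 1 b c] by auto
    have "V * 1 - U * c = 3/2 * c" by (simp add: V algebra_simps)
    moreover have "V * c - U * b = - 1 / 6" using UV(1) by (simp add: b_def)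
    ultimately show "\<exists>g. invariant_metric g2 pp g \<and> (\<forall>X\<in>pp. \<forall>Y\<in>pp. ricci g2 pp g X Y = T X Y)"
      using form3_eqI[OF ricci_form[OF g f]] g UV(2) by blast
  qed
  also have "\<dots> \<longleftrightarrow> (\<exists>U W. U > 0 \<and> t1 = 3/8 + U\<^sup>2 / 6 \<and> t2 = - 1/2 - U / 6 + W\<^sup>2 / 6
      \<and> t3 = W * (2 * U + 3) / 12)"
  proof (rule ex_cong1, rule iffI)
    fix U
    assume "\<exists>V. U > 0 \<and> 27/2 + 6 * U\<^sup>2 = A \<and> - 6 - 2 * U + 6 * V\<^sup>2 = B \<and> V * (6 * U + 9) = C"
    then obtain V where V: "U > 0" "A = 27/2 + 6 * U\<^sup>2" "B = - 6 - 2 * U + 6 * V\<^sup>2" "C = V * (6 * U + 9)"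
      by blast
    \<comment> \<open>\<open>W = k * V\<close> absorbs the scale of \<open>L\<close>: as
      \<open>k^2 = 3\<close>, the term \<open>6 * V^2 / 12\<close> becomes
      \<open>W^2 / 6\<close>.\<close>
    have "(k * V)\<^sup>2 = 3 * V\<^sup>2" by (simp add: power_mult_distrib k)
    then show "\<exists>W. U > 0 \<and> t1 = 3/8 + U\<^sup>2 / 6 \<and> t2 = - 1/2 - U / 6 + W\<^sup>2 / 6 \<and> t3 = W * (2 * U + 3) / 12"
      unfolding t V(2-4) using V(1) by (intro exI[of _ "k * V"]) (simp add: field_simps)
  next
    fix U
    assume "\<exists>W. U > 0 \<and> t1 = 3/8 + U\<^sup>2 / 6 \<and> t2 = - 1/2 - U / 6 + W\<^sup>2 / 6 \<and> t3 = W * (2 * U + 3) / 12"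
    then obtain W where W: "U > 0" "A = 27/2 + 6 * U\<^sup>2" "B = - 6 - 2 * U + 2 * W\<^sup>2" "k * C = W * (6 * U + 9)"
      unfolding t by (auto simp: field_simps)
    \<comment> \<open>Inverse of \<open>W = k * V\<close>, since \<open>k^2 = 3\<close>.\<close>
    define V where "V = k * W / 3"
    have "k * (k * C) = k * (W * (6 * U + 9))" using W(4) by simp
    then have "3 * C = k * W * (6 * U + 9)" by (simp add: k flip: mult.assoc power2_eq_square)
    then have "V * (6 * U + 9) = C" by (simp add: V_def)
    moreover have "6 * V\<^sup>2 = 2 * W\<^sup>2" by (simp add: V_def power_mult_distrib power_divide k)
    ultimately show "\<exists>V. U > 0 \<and> 27/2 + 6 * U\<^sup>2 = A \<and> - 6 - 2 * U + 6 * V\<^sup>2 = B \<and> V * (6 * U + 9) = C"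
      using W by auto
  qed
  finally show ?thesis
    unfolding ricci_image_iff .
qed

end
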